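(* Let $\mathcal X$ be a Polish space equipped with its Borel $\sigma$-field, let $L\ge 1$, and let $P_1,\ldots,P_L,Q$ be Borel probability measures on $\mathcal X$. Suppose that the tuple $(P_1,\ldots,P_L,Q)$ is jointly atomless and that $Q\notin\{P_1,\ldots,P_L\}$. For $n\ge1$ let $\ell_n$ be the optimal exact-pivotal e-power, i.e. the supremum of $\mathbb E_{Q^{\otimes n}}\log E$ over all measurable $E:\mathcal X^n\to[0,\infty)$ that are exact and pivotal (with respect to $P_1,\ldots,P_L$) and for which this extended expectation is defined. Then, in the extended interval $[0,\infty]$, $$\lim_{n\to\infty}\frac{\ell_n}{n}=\min_{1\le i\le L}D(Q\|P_i).$$ In particular, this conclusion holds when $(P_1,\ldots,P_L,Q)$ is jointly atomless, $Q\notin\{P_1,\ldots,P_L\}$, and in addition $P_i\ll Q$ for every $i$.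
   Context: All logarithms are natural, and $\log 0=-\infty$. Relative entropy: for probability measures $R,S$ on the same space, $D(R\|S)=\int\log\left(\frac{dR}{dS}\right)dR$ if $R\ll S$, and $D(R\|S)=+\infty$ otherwise. Joint atomlessness: a finite tuple $(S_1,\ldots,S_d)$ of probability measures on $\mathcal X$ is jointly atomless if there exist a probability measure $\mu$ on $\mathcal X$ dominating every $S_j$ (i.e. $S_j\ll\mu$) and a real-valued random variable $\xi$ on $\mathcal X$ (a measurable function $\xi:\mathcal X\to\mathbb R$) such that, under $\mu$, the law of $\xi$ is atomless and $\xi$ is independent of the random vector $\left(\frac{dS_1}{d\mu},\ldots,\frac{dS_d}{d\mu}\right)$. Exact and pivotal: a measurable $E:\mathcal X^n\to[0,\infty)$ is exact if $\mathbb E_{P_i^{\otimes n}}E=1$ for every $i=1,\ldots,L$, and pivotal if the law of $E$ under $P_i^{\otimes n}$ is the same for all $i=1,\ldots,L$. An extended expectation is said to be defined when at least one of the expectations of the positive and negative parts is finite. The constant $E\equiv1$ is always admissible, so $\ell_n\ge0$. *)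

theory Defs
  imports "HOL-Probability.Probability"
begin

text \<open>Natural logarithm on \<open>[0, \<infinity>]\<close> with \<open>log 0 = -\<infinity>\<close>; the real function \<^const>\<open>ln\<close> has \<open>ln 0 = 0\<close>.\<close>

definition eln :: "ennreal \<Rightarrow> ereal" where
  "eln x = (if x = 0 then -\<infinity> else if x = \<infinity> then \<infinity> else ereal (ln (enn2real x)))"

text \<open>Extended expectation, as the difference of the expectations of the positive and the negative
  part (\<^const>\<open>e2ennreal\<close> sends negative values to \<open>0\<close>). On \<^typ>\<open>ereal\<close> the difference
  \<open>\<infinity> - \<infinity>\<close> has a junk value, so the expectation is meaningful only when it is defined in the sense
  of the second definition.\<close>

definition ext_expectation :: "'a measure \<Rightarrow> ('a \<Rightarrow> ereal) \<Rightarrow> ereal" where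
  "ext_expectation M f =
     enn2ereal (\<integral>\<^sup>+x. e2ennreal (f x) \<partial>M) - enn2ereal (\<integral>\<^sup>+x. e2ennreal (- f x) \<partial>M)"

definition ext_expectation_defined :: "'a measure \<Rightarrow> ('a \<Rightarrow> ereal) \<Rightarrow> bool" where
  "ext_expectation_defined M f \<longleftrightarrow>
     (\<integral>\<^sup>+x. e2ennreal (f x) \<partial>M) < \<infinity> \<or> (\<integral>\<^sup>+x. e2ennreal (- f x) \<partial>M) < \<infinity>"

text \<open>\<open>D(R \<parallel> S)\<close>. The library's \<^const>\<open>KL_divergence\<close> is real-valued and returns \<open>0\<close> when the
  integral diverges, so it cannot express the value \<open>+\<infinity>\<close>. For probability measures the negative
  part of the integrand always has finite expectation.\<close>

definition relative_entropy :: "'a measure \<Rightarrow> 'a measure \<Rightarrow> ereal" where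
  "relative_entropy R S =
     (if absolutely_continuous S R then ext_expectation R (\<lambda>x. eln (RN_deriv S R x)) else \<infinity>)"

text \<open>The tuple is \<open>S 1, \<dots>, S d\<close>. Independence of \<open>\<xi>\<close> and the vector of densities is expressed
  through the generated \<open>\<sigma>\<close>-algebras, because \<^const>\<open>prob_space.indep_var\<close> requires both variables
  to have the same type. It does not depend on the chosen versions of the densities. The law of the
  real variable \<open>\<xi>\<close> is atomless if it gives no mass to points.\<close>

definition jointly_atomless :: "nat \<Rightarrow> (nat \<Rightarrow> 'a::topological_space measure) \<Rightarrow> bool" where
  "jointly_atomless d S \<longleftrightarrow>
     (\<exists>(\<mu> :: 'a measure) (\<xi> :: 'a \<Rightarrow> real).
        prob_space \<mu> \<and> sets \<mu> = sets borel \<and>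
        (\<forall>j\<in>{1..d}. absolutely_continuous \<mu> (S j)) \<and>
        \<xi> \<in> borel_measurable \<mu> \<and>
        (\<forall>t. emeasure (distr \<mu> borel \<xi>) {t} = 0) \<and>
        prob_space.indep_set \<mu>
          (sets (vimage_algebra (space \<mu>) \<xi> borel))
          (sets (vimage_algebra (space \<mu>) (\<lambda>x. \<lambda>j\<in>{1..d}. RN_deriv \<mu> (S j) x)
                   (\<Pi>\<^sub>M j\<in>{1..d}. borel))))"

abbreviation power_measure :: "nat \<Rightarrow> 'a measure \<Rightarrow> (nat \<Rightarrow> 'a) measure" where
  "power_measure n M \<equiv> (\<Pi>\<^sub>M k\<in>{1..n}. M)"

definition exact :: "nat \<Rightarrow> (nat \<Rightarrow> 'a measure) \<Rightarrow> nat \<Rightarrow> ((nat \<Rightarrow> 'a) \<Rightarrow> real) \<Rightarrow> bool" where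
  "exact L P n E \<longleftrightarrow> (\<forall>i\<in>{1..L}. (\<integral>\<^sup>+x. ennreal (E x) \<partial>power_measure n (P i)) = 1)"

definition pivotal :: "nat \<Rightarrow> (nat \<Rightarrow> 'a measure) \<Rightarrow> nat \<Rightarrow> ((nat \<Rightarrow> 'a) \<Rightarrow> real) \<Rightarrow> bool" where
  "pivotal L P n E \<longleftrightarrow>
     (\<forall>i\<in>{1..L}. \<forall>j\<in>{1..L}.
        distr (power_measure n (P i)) borel E = distr (power_measure n (P j)) borel E)"

definition admissible ::
  "nat \<Rightarrow> (nat \<Rightarrow> 'a::topological_space measure) \<Rightarrow> 'a measure \<Rightarrow> nat \<Rightarrow> ((nat \<Rightarrow> 'a) \<Rightarrow> real) set" where
  "admissible L P Q n =
     {E \<in> borel_measurable (power_measure n borel).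
        (\<forall>x\<in>space (power_measure n borel). 0 \<le> E x) \<and> exact L P n E \<and> pivotal L P n E \<and>
        ext_expectation_defined (power_measure n Q) (\<lambda>x. eln (ennreal (E x)))}"

definition e_power_opt ::
  "nat \<Rightarrow> (nat \<Rightarrow> 'a::topological_space measure) \<Rightarrow> 'a measure \<Rightarrow> nat \<Rightarrow> ereal" where
  "e_power_opt L P Q n =
     (SUP E\<in>admissible L P Q n. ext_expectation (power_measure n Q) (\<lambda>x. eln (ennreal (E x))))"

end

theory Submission
  imports Defs
begin

text \<open>
  Upper bound: if \<open>\<Lambda>\<close> is the density of \<open>Q\<^sup>n\<close> with respect to \<open>P\<^sub>i\<^sup>n\<close>, then
  \<open>log E \<le> log \<Lambda> + E / \<Lambda> - 1\<close>, and \<open>E / \<Lambda>\<close> has \<open>Q\<^sup>n\<close>-expectation at most \<open>1\<close>.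

  Lower bound: take \<open>E\<close> with two values, \<open>1/2\<close> on acceptance and a large constant on rejection of a
  randomized test. Then pivotality only says that the test has the same size \<open>\<alpha>\<close> under every \<open>P\<^sub>i\<^sup>n\<close>, and
  the e-power is about \<open>log (1 / \<alpha>)\<close> if the power tends to \<open>1\<close>. A Stein-type test has sizes at most
  \<open>exp (- n r)\<close> for every \<open>r < min D(Q \<parallel> P\<^sub>i)\<close>, but they depend on \<open>i\<close>. They are equalized by subtracting
  a bounded statistic whose \<open>P\<^sub>i\<^sup>n\<close>-expectation is exactly the \<open>i\<close>-th size: distinct \<open>P\<^sub>i\<close> are separated by
  events, so such statistics exist as soon as \<open>n\<close> exceeds the number of distinct \<open>P\<^sub>i\<close>. The randomization
  is provided by the first observation, which is withheld from the test: joint atomlessness yields a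
  function of it that is uniformly distributed under \<open>Q\<close> and every \<open>P\<^sub>i\<close>.
\<close>

section \<open>Randomization from joint atomlessness\<close>

text \<open>Half of the probability integral transform. Without atoms the distribution function is
  continuous, so it attains \<open>t\<close>. It may be constant on an interval there, hence the
  sublevel set is identified as the half-line ending at its supremum, where the value is still
  \<open>t\<close>.\<close>

lemma (in real_distribution) emeasure_cdf_le:
  assumes atomless: "\<And>x. emeasure M {x} = 0" and t: "0 < t" "t < 1"
  shows "emeasure M {x. cdf M x \<le> t} = ennreal t"
proof -
  have cont: "isCont (cdf M) x" for x
    using atomless[of x] by (simp add: isCont_cdf measure_def)
  have "\<forall>\<^sub>F x in at_top. cdf M x > t"
    using cdf_lim_at_top_prob t(2) by (rule order_tendstoD)
  then obtain b where b: "\<And>x. x \<ge> b \<Longrightarrow> cdf M x > t"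
    by (auto simp: eventually_at_top_linorder)
  have "\<forall>\<^sub>F x in at_bot. cdf M x < t"
    using cdf_lim_at_bot t(1) by (rule order_tendstoD)
  then obtain a where a: "\<And>x. x \<le> a \<Longrightarrow> cdf M x < t"
    by (auto simp: eventually_at_bot_linorder)
  have "a \<le> b"
    using a[of b] b[of b] by force
  have "\<exists>x\<ge>a. x \<le> b \<and> cdf M x = t"
    using IVT[of "cdf M" a t b] a[of a] b[of b] \<open>a \<le> b\<close> cont by force
  then obtain x0 where x0: "cdf M x0 = t" by blast
  define T where "T = {x. cdf M x \<le> t}"
  have T: "T \<noteq> {}" "bdd_above T"
    using x0 b unfolding T_def by (auto intro!: bdd_aboveI[of _ b] simp: not_less[symmetric] intro: less_imp_le)
  have "closed T"
    unfolding T_def using cont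
    by (intro closed_Collect_le continuous_at_imp_continuous_on) auto
  then have "Sup T \<in> T"
    using T by (simp add: closed_contains_Sup)
  then have T_eq: "T = {..Sup T}"
    using T cdf_nondecreasing unfolding T_def by (auto intro: cSup_upper order_trans)
  have "cdf M (Sup T) = t"
    using \<open>Sup T \<in> T\<close> cdf_nondecreasing[of x0 "Sup T"] cSup_upper[of x0 T] T x0
    by (auto simp: T_def)
  then show ?thesis
    using T_eq unfolding T_def[symmetric] by (simp add: cdf_def emeasure_eq_measure)
qed

text \<open>Independence from the densities makes the law of \<open>\<xi>\<close> the same under
  every \<open>S j\<close> as under \<open>\<mu>\<close>: weighting an event of \<open>\<xi>\<close>
  by an independent density of mean 1 does not change its probability. Composing
  \<open>\<xi>\<close> with its distribution function under \<open>\<mu>\<close> then gives one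
  statistic that is uniform under all \<open>S j\<close> at once.\<close>

lemma jointly_atomless_imp_uniform:
  fixes S :: "nat \<Rightarrow> 'a::topological_space measure"
  assumes ja: "jointly_atomless d S"
    and S: "\<And>j. j \<in> {1..d} \<Longrightarrow> prob_space (S j)" "\<And>j. j \<in> {1..d} \<Longrightarrow> sets (S j) = sets borel"
  obtains U :: "'a \<Rightarrow> real" where "U \<in> borel_measurable borel"
    "\<And>j t. j \<in> {1..d} \<Longrightarrow> 0 < t \<Longrightarrow> t < 1 \<Longrightarrow> emeasure (S j) {x. U x \<le> t} = ennreal t"
proof -
  from ja obtain \<mu> :: "'a measure" and \<xi> :: "'a \<Rightarrow> real" where
    prob: "prob_space \<mu>" and [measurable_cong]: "sets \<mu> = sets borel"
    and ac: "\<And>j. j \<in> {1..d} \<Longrightarrow> absolutely_continuous \<mu> (S j)"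
    and xi[measurable]: "\<xi> \<in> borel_measurable \<mu>"
    and atomless: "\<And>t. emeasure (distr \<mu> borel \<xi>) {t} = 0"
    and ind: "prob_space.indep_set \<mu> (sets (vimage_algebra (space \<mu>) \<xi> borel))
          (sets (vimage_algebra (space \<mu>) (\<lambda>x. \<lambda>j\<in>{1..d}. RN_deriv \<mu> (S j) x) (\<Pi>\<^sub>M j\<in>{1..d}. borel)))"
    unfolding jointly_atomless_def by blast
  interpret prob_space \<mu> by (rule prob)
  interpret D: real_distribution "distr \<mu> borel \<xi>" by simp
  define F where "F = cdf (distr \<mu> borel \<xi>)"
  have sp: "space \<mu> = UNIV"
    using sets_eq_imp_space_eq[OF \<open>sets \<mu> = sets borel\<close>] by simp
  have mono_F: "mono F"
    unfolding F_def by (rule monoI) (rule D.cdf_nondecreasing)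
  have [measurable]: "F \<in> borel_measurable borel"
    using mono_F by (rule borel_measurable_mono)
  have xi_borel[measurable]: "\<xi> \<in> borel_measurable borel"
    using xi by simp
  have law: "emeasure (S j) (\<xi> -` A) = emeasure (distr \<mu> borel \<xi>) A"
    if j: "j \<in> {1..d}" and A[measurable]: "A \<in> sets borel" for j A
  proof -
    let ?f = "RN_deriv \<mu> (S j)" and ?g = "\<lambda>x. indicator A (\<xi> x) :: ennreal"
    \<comment> \<open>Independence passes to smaller sigma-algebras: an indicator of
      \<open>\<xi>\<close> and one coordinate of the density vector suffice. Both take values in
      \<open>ennreal\<close>, so the product rule for nonnegative integrals can be applied.\<close>
    have *: "indep_var borel ?g borel ?f"
      unfolding indep_var_eq
    proof (intro conjI)
      show "indep_set (sigma_sets (space \<mu>) {?g -` B \<inter> space \<mu> |B. B \<in> sets borel})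
          (sigma_sets (space \<mu>) {?f -` B \<inter> space \<mu> |B. B \<in> sets borel})"
        using ind unfolding indep_set_def
      proof (rule indep_sets_mono_sets)
        have 1: "\<xi> \<in> vimage_algebra (space \<mu>) \<xi> borel \<rightarrow>\<^sub>M borel"
          by (rule measurable_vimage_algebra1) auto
        have 2: "?g \<in> vimage_algebra (space \<mu>) \<xi> borel \<rightarrow>\<^sub>M borel"
          by (rule measurable_compose[OF 1]) auto
        let ?V = "vimage_algebra (space \<mu>) (\<lambda>x. \<lambda>j\<in>{1..d}. RN_deriv \<mu> (S j) x) (\<Pi>\<^sub>M j\<in>{1..d}. borel) :: 'a measure"
        have 3: "(\<lambda>x. \<lambda>j\<in>{1..d}. RN_deriv \<mu> (S j) x) \<in> ?V \<rightarrow>\<^sub>M (\<Pi>\<^sub>M j\<in>{1..d}. borel)"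
          by (rule measurable_vimage_algebra1) (auto simp: space_PiM)
        have 4: "?f \<in> ?V \<rightarrow>\<^sub>M borel"
          using measurable_compose[OF 3 measurable_component_singleton[OF j]] j by simp
        show "case_bool (sigma_sets (space \<mu>) {?g -` B \<inter> space \<mu> |B. B \<in> sets borel})
            (sigma_sets (space \<mu>) {?f -` B \<inter> space \<mu> |B. B \<in> sets borel}) i
          \<subseteq> case_bool (sets (vimage_algebra (space \<mu>) \<xi> borel)) (sets ?V) i" for i
        proof (cases i)
          case True
          have "sigma_sets (space (vimage_algebra (space \<mu>) \<xi> borel)) {?g -` B \<inter> space \<mu> |B. B \<in> sets borel}
              \<subseteq> sets (vimage_algebra (space \<mu>) \<xi> borel)"
            using measurable_sets[OF 2] by (intro sets.sigma_sets_subset) auto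
          then show ?thesis using True by simp
        next
          case False
          have "sigma_sets (space ?V) {?f -` B \<inter> space \<mu> |B. B \<in> sets borel} \<subseteq> sets ?V"
            using measurable_sets[OF 4] by (intro sets.sigma_sets_subset) auto
          then show ?thesis using False by simp
        qed
      qed
    qed measurable
    interpret Sj: prob_space "S j" using S(1)[OF j] .
    have dens: "density \<mu> ?f = S j"
      using ac[OF j] S(2)[OF j] \<open>sets \<mu> = sets borel\<close> by (intro density_RN_deriv) auto
    have f1: "(\<integral>\<^sup>+x. ?f x \<partial>\<mu>) = 1"
      using Sj.emeasure_space_1 emeasure_density[of ?f \<mu> "space \<mu>"]
      by (simp add: dens sp sets_eq_imp_space_eq[OF S(2)[OF j]] cong: nn_integral_cong)
    \<comment> \<open>\<open>indep_var\<close> is independence of a family indexed by the booleans;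
      the product rule is stated for a constant family of target spaces.\<close>
    have borel_eq: "case_bool borel borel = (\<lambda>_. borel :: ennreal measure)"
      by (auto simp: fun_eq_iff split: bool.split)
    have "(\<integral>\<^sup>+x. (\<Prod>b\<in>UNIV. (case b of True \<Rightarrow> ?g | False \<Rightarrow> ?f) x) \<partial>\<mu>)
        = (\<Prod>b\<in>UNIV. \<integral>\<^sup>+x. (case b of True \<Rightarrow> ?g | False \<Rightarrow> ?f) x \<partial>\<mu>)"
      using * unfolding indep_var_def borel_eq by (intro indep_vars_nn_integral) auto
    then have prod: "(\<integral>\<^sup>+x. ?g x * ?f x \<partial>\<mu>) = (\<integral>\<^sup>+x. ?g x \<partial>\<mu>)"
      by (simp add: UNIV_bool f1 mult.commute)
    have "emeasure (S j) (\<xi> -` A) = (\<integral>\<^sup>+x. ?f x * indicator (\<xi> -` A) x \<partial>\<mu>)"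
      using dens by (subst dens[symmetric], subst emeasure_density) (use measurable_sets[OF xi A] in \<open>auto simp: sp\<close>)
    also have "\<dots> = (\<integral>\<^sup>+x. ?g x * ?f x \<partial>\<mu>)"
      by (simp add: mult.commute indicator_def)
    also have "\<dots> = emeasure (distr \<mu> borel \<xi>) A"
      unfolding prod by (simp add: nn_integral_distr[symmetric, of \<xi> \<mu> borel "indicator A"])
    finally show ?thesis .
  qed
  show thesis
  proof (rule that)
    show "(\<lambda>x. F (\<xi> x)) \<in> borel_measurable borel" by measurable
    fix j and t :: real assume j: "j \<in> {1..d}" and t: "0 < t" "t < 1"
    have "{x. F (\<xi> x) \<le> t} = \<xi> -` {x. F x \<le> t}" by auto
    then show "emeasure (S j) {x. F (\<xi> x) \<le> t} = ennreal t"
      using law[OF j, of "{x. F x \<le> t}"] D.emeasure_cdf_le[OF atomless t] by (simp add: F_def[symmetric])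
  qed
qed

section \<open>Likelihood ratios and relative entropy\<close>

lemma eln_ennreal: "0 < x \<Longrightarrow> eln (ennreal x) = ereal (ln x)"
  by (auto simp: eln_def)

lemma eln_finite: "0 < x \<Longrightarrow> x < \<infinity> \<Longrightarrow> eln x = ereal (ln (enn2real x))"
  by (auto simp: eln_def)

lemma borel_measurable_eln [measurable]: "eln \<in> borel_measurable borel"
  unfolding eln_def by measurable

text \<open>For positive finite \<open>x\<close> this is \<open>ln (1 / x) \<le> 1 / x - 1\<close>
  multiplied by \<open>x\<close>. At zero the convention \<open>0 * \<infinity> = 0\<close> applies,
  and at infinity the second factor vanishes.\<close>

lemma mult_neg_eln_le_1: "x * e2ennreal (- eln x) \<le> 1"
proof (cases x)
  case (real u)
  show ?thesis
  proof (cases "u = 0")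
    case False
    with real have u: "u > 0" by simp
    have "- ln u \<le> 1 / u"
      using ln_le_minus_one[of "1 / u"] u by (simp add: ln_div)
    then have "u * (- ln u) \<le> 1"
      using u by (simp add: field_simps)
    moreover have "e2ennreal (- eln x) = ennreal (- ln u)"
      using u real by (simp add: eln_ennreal e2ennreal_ereal)
    ultimately show ?thesis
      using u real by (simp add: ennreal_mult'[symmetric] ennreal_le_1 del: mult_minus_right)
  qed (use real in simp)
next
  case top
  then show ?thesis by (simp add: eln_def e2ennreal_neg)
qed

locale dominated_prob =
  P: prob_space P + Q: prob_space Q for P Q :: "'a measure" +
  assumes sets_eq: "sets Q = sets P" and ac: "absolutely_continuous P Q"
begin

text \<open>A real-valued version of the density. It differs from \<open>RN_deriv\<close> only where
  the latter is infinite, a null set for \<open>P\<close> and hence for \<open>Q\<close>.\<close>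

definition lik :: "'a \<Rightarrow> real" where "lik x = enn2real (RN_deriv P Q x)"

lemma borel_measurable_lik [measurable]: "lik \<in> borel_measurable P"
  unfolding lik_def by measurable

lemma density_RN: "density P (RN_deriv P Q) = Q"
  using ac sets_eq by (rule P.density_RN_deriv)

lemma RN_finite: "AE x in P. RN_deriv P Q x < \<infinity>"
  using P.RN_deriv_finite[OF Q.sigma_finite_measure ac sets_eq] by (simp add: less_top)

lemma density_lik: "density P (\<lambda>x. ennreal (lik x)) = Q"
proof -
  have "density P (\<lambda>x. ennreal (lik x)) = density P (RN_deriv P Q)"
    using RN_finite by (intro density_cong) (auto simp: lik_def)
  then show ?thesis by (simp add: density_RN)
qed

lemma RN_pos_finite: "AE x in Q. 0 < RN_deriv P Q x \<and> RN_deriv P Q x < \<infinity>"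
  by (subst density_RN[symmetric], subst AE_density) (use RN_finite in auto)

lemma lik_nonneg: "0 \<le> lik x" by (simp add: lik_def)

lemma lik_pos: "AE x in Q. 0 < lik x"
  using RN_pos_finite by eventually_elim (auto simp: lik_def enn2real_positive_iff)

lemma relative_entropy_lik:
  "relative_entropy Q P =
     enn2ereal (\<integral>\<^sup>+x. ennreal (ln (lik x)) \<partial>Q) - enn2ereal (\<integral>\<^sup>+x. ennreal (- ln (lik x)) \<partial>Q)"
proof -
  have "(\<integral>\<^sup>+x. e2ennreal (eln (RN_deriv P Q x)) \<partial>Q) = (\<integral>\<^sup>+x. ennreal (ln (lik x)) \<partial>Q)"
    using RN_pos_finite by (intro nn_integral_cong_AE, eventually_elim) (auto simp: lik_def eln_finite e2ennreal_ereal)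
  moreover have "(\<integral>\<^sup>+x. e2ennreal (- eln (RN_deriv P Q x)) \<partial>Q) = (\<integral>\<^sup>+x. ennreal (- ln (lik x)) \<partial>Q)"
    using RN_pos_finite by (intro nn_integral_cong_AE, eventually_elim) (auto simp: lik_def eln_finite e2ennreal_ereal)
  ultimately show ?thesis
    using ac by (simp add: relative_entropy_def ext_expectation_def)
qed

text \<open>Changing measure to \<open>P\<close> multiplies the integrand by the density, and the
  product is at most 1 pointwise. So the difference in \<open>relative_entropy_lik\<close> never has
  the form \<open>\<infinity> - \<infinity>\<close>.\<close>

lemma neg_part_finite: "(\<integral>\<^sup>+x. ennreal (- ln (lik x)) \<partial>Q) \<le> 1"
proof -
  have "(\<integral>\<^sup>+x. ennreal (- ln (lik x)) \<partial>Q) = (\<integral>\<^sup>+x. e2ennreal (- eln (RN_deriv P Q x)) \<partial>Q)"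
    using RN_pos_finite by (intro nn_integral_cong_AE, eventually_elim) (auto simp: lik_def eln_finite e2ennreal_ereal)
  also have "\<dots> = (\<integral>\<^sup>+x. e2ennreal (- eln (RN_deriv P Q x)) \<partial>density P (RN_deriv P Q))"
    by (simp add: density_RN)
  also have "\<dots> = (\<integral>\<^sup>+x. RN_deriv P Q x * e2ennreal (- eln (RN_deriv P Q x)) \<partial>P)"
    by (rule nn_integral_density) measurable
  also have "\<dots> \<le> (\<integral>\<^sup>+x. 1 \<partial>P)"
    by (intro nn_integral_mono mult_neg_eln_le_1)
  finally show ?thesis by (simp add: P.emeasure_space_1)
qed

lemma integral_lik: "integrable P lik" "(\<integral>x. lik x \<partial>P) = 1"
proof -
  have "(\<integral>\<^sup>+x. ennreal (lik x) \<partial>P) = emeasure (density P (\<lambda>x. ennreal (lik x))) (space P)"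
    by (simp add: emeasure_density cong: nn_integral_cong)
  also have "\<dots> = 1"
    using Q.emeasure_space_1 sets_eq_imp_space_eq[OF sets_eq] by (simp add: density_lik)
  finally have "(\<integral>\<^sup>+x. ennreal (lik x) \<partial>P) = ennreal 1" by simp
  then have "has_bochner_integral P lik 1"
    by (intro has_bochner_integral_nn_integral) (auto simp: lik_nonneg)
  then show "integrable P lik" "(\<integral>x. lik x \<partial>P) = 1"
    by (auto simp: has_bochner_integral_iff)
qed

end

section \<open>Approximating relative entropy by bounded exponents\<close>

text \<open>The approximation half of the Donsker--Varadhan formula. Restricting to bounded functions \<open>h\<close> covers
  infinite relative entropy and the failure of absolute continuity uniformly.\<close>

lemma less_relative_entropy_imp_bounded_exponent:
  fixes P Q :: "'a measure" and r :: real
  assumes "prob_space P" "prob_space Q" and sets_eq: "sets Q = sets P"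
    and r: "ereal r < relative_entropy Q P"
  obtains h B where "h \<in> borel_measurable P" "\<And>x. \<bar>h x\<bar> \<le> (B::real)"
    "(\<integral>x. exp (h x) \<partial>P) \<le> 1" "r < (\<integral>x. h x \<partial>Q)"
proof (cases "absolutely_continuous P Q")
  case False
  interpret P: prob_space P by fact
  interpret Q: prob_space Q by fact
  from False obtain N where N: "N \<in> null_sets P" "N \<notin> null_sets Q"
    by (auto simp: absolutely_continuous_def)
  then have N_sets[measurable]: "N \<in> sets P" "N \<in> sets Q" using sets_eq by auto
  define q where "q = measure Q N"
  have "emeasure Q N \<noteq> 0" using N(2) N_sets by auto
  then have q: "q > 0" by (simp add: q_def Q.emeasure_eq_measure zero_less_measure_iff)
  \<comment> \<open>A multiple of the indicator of \<open>N\<close> is invisible to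
    \<open>P\<close>. This multiple has mean \<open>\<bar>r\<bar> + 1 > r\<close> under
    \<open>Q\<close>.\<close>
  define K where "K = (\<bar>r\<bar> + 1) / q"
  have K: "K \<ge> 0" using q by (simp add: K_def)
  have "AE x in P. exp (K * indicator N x) = 1"
    using AE_not_in[OF N(1)] by eventually_elim simp
  then have "(\<integral>x. exp (K * indicator N x) \<partial>P) = (\<integral>x. 1 \<partial>P)"
    by (intro integral_cong_AE) auto
  moreover have "(\<integral>x. K * indicator N x \<partial>Q) = \<bar>r\<bar> + 1"
    using q by (simp add: K_def q_def)
  ultimately show thesis
    using K by (intro that[of "\<lambda>x. K * indicator N x" K]) (auto simp: P.prob_space indicator_def)
next
  case True
  interpret dominated_prob P Q
    using assms True by (simp add: dominated_prob_def dominated_prob_axioms_def)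
  note [measurable_cong] = sets_eq
  \<comment> \<open>The log-likelihood ratio truncated to the interval from \<open>- K\<close> to
    \<open>K\<close>. Truncating inside the logarithm gives the value \<open>- K\<close> where
    \<open>lik x = 0\<close>, whereas \<open>ln 0\<close> would be 0.\<close>
  define h where "h K x = ln (max (exp (- real K)) (min (exp (real K)) (lik x)))" for K x
  have [measurable]: "h K \<in> borel_measurable P" for K unfolding h_def by measurable
  have h_alt: "exp (h K x) = max (exp (- real K)) (min (exp (real K)) (lik x))" for K x
    unfolding h_def by (rule exp_ln) (simp add: less_max_iff_disj)
  have h_bounds: "- real K \<le> h K x" "h K x \<le> real K" for K x
    using h_alt[of K x] by (subst exp_le_cancel_iff[symmetric], simp)+
  have h_pos: "h K x = max (- real K) (min (real K) (ln (lik x)))" if "lik x > 0" for K x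
  proof -
    have "exp (max a b) = max (exp a) (exp b)" "exp (min a b) = min (exp a) (exp b)" for a b :: real
      by (simp_all add: max_def min_def)
    then have "exp (h K x) = exp (max (- real K) (min (real K) (ln (lik x))))"
      using that by (simp add: h_alt)
    then show ?thesis by simp
  qed
  have h0: "h K x = - real K" if "lik x = 0" for K x
    using that by (simp add: h_def)
  have int_h: "integrable Q (h K)" for K
    by (rule Q.integrable_const_bound[where B="real K"]) (use h_bounds in \<open>auto simp: abs_le_iff minus_le_iff\<close>)
  \<comment> \<open>\<open>ennreal\<close> sends negative numbers to 0, so this is monotone
    convergence of the positive parts only. The negative parts are merely bounded by the finite
    number \<open>neg\<close> below.\<close>
  have lim: "(\<lambda>K. \<integral>\<^sup>+x. ennreal (h K x) \<partial>Q) \<longlonglongrightarrow> (\<integral>\<^sup>+x. ennreal (ln (lik x)) \<partial>Q)"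
  proof (rule nn_integral_LIMSEQ)
    show "incseq (\<lambda>K x. ennreal (h K x))"
    proof (intro incseq_SucI le_funI)
      fix K x
      show "ennreal (h K x) \<le> ennreal (h (Suc K) x)"
      proof (cases "lik x = 0")
        case False
        then have "lik x > 0" using lik_nonneg[of x] by simp
        moreover have "ennreal (max (- real K) (min (real K) l)) \<le> ennreal (max (- real (Suc K)) (min (real (Suc K)) l))" for l
          by (cases "l \<ge> 0") (auto simp: ennreal_neg min_def max_def intro!: ennreal_leI)
        ultimately show ?thesis by (simp only: h_pos)
      qed (simp add: h0 ennreal_neg)
    qed
    show "(\<lambda>K. ennreal (h K x)) \<longlonglongrightarrow> ennreal (ln (lik x))" for x
    proof (cases "lik x = 0")
      case False
      then have "lik x > 0" using lik_nonneg[of x] by simp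
      obtain K0 where K0: "\<bar>ln (lik x)\<bar> \<le> real K0" using real_arch_simple by blast
      have "\<forall>\<^sub>F K in sequentially. ennreal (h K x) = ennreal (ln (lik x))"
        using eventually_ge_at_top[of K0]
      proof eventually_elim
        case (elim K)
        then have "real K0 \<le> real K" by simp
        then show ?case using K0 \<open>lik x > 0\<close> by (auto simp: h_pos)
      qed
      then show ?thesis by (rule tendsto_eventually)
    qed (simp add: h0 ennreal_neg)
  qed measurable
  define neg where "neg = enn2real (\<integral>\<^sup>+x. ennreal (- ln (lik x)) \<partial>Q)"
  have neg: "(\<integral>\<^sup>+x. ennreal (- ln (lik x)) \<partial>Q) = ennreal neg" "neg \<ge> 0"
    using neg_part_finite by (auto simp: neg_def ennreal_enn2real_if top_unique)
  have neg_h: "enn2real (\<integral>\<^sup>+x. ennreal (- h K x) \<partial>Q) \<le> neg" for K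
  proof -
    have "(\<integral>\<^sup>+x. ennreal (- h K x) \<partial>Q) \<le> (\<integral>\<^sup>+x. ennreal (- ln (lik x)) \<partial>Q)"
    proof (intro nn_integral_mono_AE, use lik_pos in eventually_elim)
      case (elim x)
      moreover have "ennreal (- max (- real K) (min (real K) l)) \<le> ennreal (- l)" for l
        by (cases "l \<ge> 0") (auto simp: ennreal_neg min_def max_def intro!: ennreal_leI)
      ultimately show ?case by (simp only: h_pos)
    qed
    then show ?thesis unfolding neg by (simp add: enn2real_leI neg)
  qed
  \<comment> \<open>The gap between \<open>r\<close> and \<open>r'\<close> pays for the normalizing
    constant \<open>c\<close> subtracted from \<open>h K\<close> later.\<close>
  obtain r' where r': "r < r'" "ereal r' < relative_entropy Q P"
    using ereal_dense2[OF r] by auto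
  have "ereal (r' + neg) < enn2ereal (\<integral>\<^sup>+x. ennreal (ln (lik x)) \<partial>Q)"
    using r'(2) neg unfolding relative_entropy_lik neg(1)
    by (cases "enn2ereal (\<integral>\<^sup>+x. ennreal (ln (lik x)) \<partial>Q)") (auto simp: enn2ereal_ennreal)
  have ev1: "\<forall>\<^sub>F K in sequentially. r' + neg \<le> enn2real (\<integral>\<^sup>+x. ennreal (h K x) \<partial>Q)"
  proof (cases "r' + neg < 0")
    case True
    then show ?thesis by (auto intro!: always_eventually order_trans[OF less_imp_le[OF True]])
  next
    case False
    then have "ennreal (r' + neg) < (\<integral>\<^sup>+x. ennreal (ln (lik x)) \<partial>Q)"
      using \<open>ereal (r' + neg) < _\<close> by (simp add: less_ennreal.rep_eq enn2ereal_ennreal)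
    from order_tendstoD(1)[OF lim this] show ?thesis
    proof eventually_elim
      case (elim K)
      have "(\<integral>\<^sup>+x. ennreal (h K x) \<partial>Q) \<le> (\<integral>\<^sup>+x. ennreal (real K) \<partial>Q)"
        by (intro nn_integral_mono ennreal_leI h_bounds)
      then have "(\<integral>\<^sup>+x. ennreal (h K x) \<partial>Q) < \<infinity>"
        by (simp add: Q.emeasure_space_1 less_top[symmetric] top_unique) (auto simp: top_unique)
      then show ?case
        using elim False by (cases "\<integral>\<^sup>+x. ennreal (h K x) \<partial>Q") (auto simp: ennreal_less_iff)
    qed
  qed
  have "(\<lambda>K. ln (1 + exp (- real K))) \<longlonglongrightarrow> ln (1 + 0)"
    by (intro tendsto_intros filterlim_compose[OF exp_at_bot]
        filterlim_compose[OF filterlim_uminus_at_bot_at_top] filterlim_real_sequentially) simp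
  then have ev2: "\<forall>\<^sub>F K in sequentially. ln (1 + exp (- real K)) < r' - r"
    using r' by (intro order_tendstoD(2)[where y="ln (1 + 0)"]) auto
  from eventually_happens'[OF sequentially_bot eventually_conj[OF ev1 ev2]]
  obtain K where K: "r' + neg \<le> enn2real (\<integral>\<^sup>+x. ennreal (h K x) \<partial>Q)" "ln (1 + exp (- real K)) < r' - r"
    by auto
  \<comment> \<open>Since \<open>exp (h K x) \<le> exp (- K) + lik x\<close>, its
    \<open>P\<close>-mean is at most \<open>1 + exp (- K)\<close>; truncation from below may raise
    it above 1. Subtracting \<open>c\<close> brings it back to at most 1.\<close>
  define c where "c = ln (1 + exp (- real K))"
  have exp_c: "exp c = 1 + exp (- real K)" unfolding c_def by (simp add: add_pos_pos)
  have "c \<ge> 0" unfolding c_def by simp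
  show thesis
  proof (rule that)
    show "(\<lambda>x. h K x - c) \<in> borel_measurable P" by measurable
    show "\<bar>h K x - c\<bar> \<le> real K + c" for x
      using h_bounds[of K x] \<open>c \<ge> 0\<close> by (auto simp: abs_le_iff)
    have "(\<integral>x. exp (h K x - c) \<partial>P) \<le> (\<integral>x. (exp (- real K) + lik x) / exp c \<partial>P)"
    proof (rule integral_mono)
      show "integrable P (\<lambda>x. exp (h K x - c))"
      proof (rule P.integrable_const_bound[where B="exp (real K)"])
        have "h K x - c \<le> real K" for x
          using h_bounds(2)[of K x] \<open>c \<ge> 0\<close> by linarith
        then show "AE x in P. norm (exp (h K x - c)) \<le> exp (real K)" by simp
      qed measurable
      show "integrable P (\<lambda>x. (exp (- real K) + lik x) / exp c)"
        using integral_lik by simp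
      show "exp (h K x - c) \<le> (exp (- real K) + lik x) / exp c" for x
        using lik_nonneg[of x] by (auto simp: exp_diff h_alt intro!: divide_right_mono min.coboundedI2)
    qed
    also have "\<dots> = 1"
      using integral_lik by (simp add: exp_c P.prob_space add_pos_pos less_imp_neq[symmetric] add.commute)
    finally show "(\<integral>x. exp (h K x - c) \<partial>P) \<le> 1" .
    have "(\<integral>x. h K x - c \<partial>Q) = (\<integral>x. h K x \<partial>Q) - c"
      using int_h by (simp add: Q.prob_space)
    moreover have "r' \<le> (\<integral>x. h K x \<partial>Q)"
      using K(1) neg_h[of K] unfolding real_lebesgue_integral_def[OF int_h] by linarith
    ultimately show "r < (\<integral>x. h K x - c \<partial>Q)" using K(2) by (simp add: c_def)
  qed
qed

section \<open>Testing a finite family with exponentially small errors\<close>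

text \<open>For \<open>y = - x\<close> with \<open>x > 0\<close> the claim becomes
  \<open>1 \<le> (1 - x + x\<^sup>2) * exp x\<close>. Replacing \<open>exp x\<close> by its
  quadratic Taylor polynomial, a lower bound, leaves 1 plus a polynomial with nonnegative
  coefficients.\<close>

lemma exp_le_quadratic:
  fixes y :: real
  assumes "\<bar>y\<bar> \<le> 1"
  shows "exp y \<le> 1 + y + y\<^sup>2"
proof (cases "y \<ge> 0")
  case True
  then show ?thesis using exp_bound[of y] assms by simp
next
  case False
  define x where "x = - y"
  have x: "x \<ge> 0" using False by (simp add: x_def)
  have "1 \<le> (1 - x + x\<^sup>2) * (1 + x + x\<^sup>2 / 2)"
  proof -
    have "(1 - x + x\<^sup>2) * (1 + x + x\<^sup>2 / 2) = 1 + (x\<^sup>2 + x ^ 3 + x ^ 4) / 2"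
      by (simp add: field_simps power2_eq_square power3_eq_cube power4_eq_xxxx)
    then show ?thesis using x by simp
  qed
  also have "\<dots> \<le> (1 - x + x\<^sup>2) * exp x"
  proof (rule mult_left_mono)
    show "1 + x + x\<^sup>2 / 2 \<le> exp x" using exp_lower_Taylor_quadratic[OF x] by simp
    have "1 - x + x\<^sup>2 = (1 - x / 2)\<^sup>2 + 3 / 4 * x\<^sup>2"
      by (simp add: power2_eq_square field_simps)
    then show "0 \<le> 1 - x + x\<^sup>2" by simp
  qed
  finally have "exp (- x) \<le> 1 - x + x\<^sup>2"
    by (simp add: exp_minus field_simps)
  then show ?thesis by (simp add: x_def)
qed

text \<open>The moment is 1 minus \<open>t\<close> times the positive mean of \<open>h - r\<close>,
  up to an error of order \<open>t\<^sup>2\<close>. This gives the exponential decay, under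
  \<open>Q\<close>, of the probability that an average of \<open>h\<close> falls below
  \<open>r\<close>.\<close>

lemma (in prob_space) exponential_tilt:
  fixes h :: "'a \<Rightarrow> real"
  assumes [measurable]: "h \<in> borel_measurable M" and bnd: "\<And>x. \<bar>h x\<bar> \<le> B"
    and r: "r < (\<integral>x. h x \<partial>M)"
  obtains t where "t > 0" "(\<integral>x. exp (- t * (h x - r)) \<partial>M) < 1"
proof -
  define b where "b = B + \<bar>r\<bar> + 1"
  have "B \<ge> 0" using bnd[of undefined] by linarith
  then have b: "b > 0" by (simp add: b_def add_nonneg_pos)
  have gb: "\<bar>h x - r\<bar> \<le> b" for x using bnd[of x] by (simp add: b_def)
  have int_h: "integrable M h"
    by (rule integrable_const_bound[where B=B]) (use bnd in auto)
  define m where "m = (\<integral>x. h x \<partial>M) - r"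
  have m: "m > 0" using r by (simp add: m_def)
  \<comment> \<open>The first bound keeps the exponent within the range of
    \<open>exp_le_quadratic\<close>; the second makes the quadratic term at most half of the linear
    gain \<open>t * m\<close>.\<close>
  define t where "t = min (1 / b) (m / (2 * b\<^sup>2))"
  have t: "t > 0" "t \<le> 1 / b" "t \<le> m / (2 * b\<^sup>2)" using b m by (auto simp: t_def)
  have tg: "\<bar>t * (h x - r)\<bar> \<le> t * b" for x
    using gb[of x] t by (simp add: abs_mult)
  have tb: "t * b \<le> 1" using t b by (simp add: field_simps)
  have bound: "exp (- t * (h x - r)) \<le> 1 - t * (h x - r) + t\<^sup>2 * b\<^sup>2" for x
  proof -
    have "exp (- t * (h x - r)) \<le> 1 + (- t * (h x - r)) + (- t * (h x - r))\<^sup>2"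
      using tg[of x] tb by (intro exp_le_quadratic) simp
    also have "(- t * (h x - r))\<^sup>2 \<le> (t * b)\<^sup>2"
      using tg[of x] by (intro power2_le_iff_abs_le[THEN iffD2]) (auto simp: t(1) b less_imp_le)
    finally show ?thesis by (simp add: power_mult_distrib)
  qed
  have "(\<integral>x. exp (- t * (h x - r)) \<partial>M) \<le> (\<integral>x. 1 - t * (h x - r) + t\<^sup>2 * b\<^sup>2 \<partial>M)"
  proof (rule integral_mono)
    show "integrable M (\<lambda>x. exp (- t * (h x - r)))"
    proof (rule integrable_const_bound[where B="exp 1"])
      have "- t * (h x - r) \<le> 1" for x using tg[of x] tb by simp
      then show "AE x in M. norm (exp (- t * (h x - r))) \<le> exp 1" by simp
    qed measurable
    show "integrable M (\<lambda>x. 1 - t * (h x - r) + t\<^sup>2 * b\<^sup>2)" using int_h by simp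
  qed (rule bound)
  also have "\<dots> = 1 - t * m + t\<^sup>2 * b\<^sup>2"
    using int_h by (simp add: prob_space m_def right_diff_distrib)
  also have "\<dots> < 1"
  proof -
    have "t * b\<^sup>2 \<le> m / 2" using t(3) b by (simp add: field_simps)
    then have "t * (t * b\<^sup>2) \<le> t * (m / 2)" using t(1) by (intro mult_left_mono) auto
    also have "\<dots> < t * m" using t(1) m by simp
    finally show ?thesis by (simp add: power2_eq_square mult.assoc)
  qed
  finally show thesis using t(1) that by blast
qed

text \<open>The indicator of a nonnegative sum is at most the exponential of the sum, whose
  expectation factorizes. Any slope is absorbed into \<open>g\<close>, so the same bound serves both
  kinds of error in \<open>stein_test\<close>.\<close>

lemma (in prob_space) chernoff_product:
  fixes g :: "'a \<Rightarrow> real"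
  assumes [measurable]: "g \<in> borel_measurable M" and bnd: "\<And>x. \<bar>g x\<bar> \<le> B" and J: "finite J"
  shows "measure (\<Pi>\<^sub>M k\<in>J. M) {x \<in> space (\<Pi>\<^sub>M k\<in>J. M). 0 \<le> (\<Sum>k\<in>J. g (x k))}
    \<le> (\<integral>x. exp (g x) \<partial>M) ^ card J"
proof -
  interpret PS: product_prob_space "\<lambda>_. M" by standard
  interpret PJ: prob_space "\<Pi>\<^sub>M k\<in>J. M" by (intro prob_space_PiM prob_space_axioms)
  let ?A = "{x \<in> space (\<Pi>\<^sub>M k\<in>J. M). 0 \<le> (\<Sum>k\<in>J. g (x k))}"
  have int: "integrable M (\<lambda>x. exp (g x))"
  proof (rule integrable_const_bound[where B="exp B"])
    have "g x \<le> B" for x using bnd[of x] by simp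
    then show "AE x in M. norm (exp (g x)) \<le> exp B" by simp
  qed measurable
  have "emeasure (\<Pi>\<^sub>M k\<in>J. M) ?A = (\<integral>\<^sup>+x. indicator ?A x \<partial>(\<Pi>\<^sub>M k\<in>J. M))"
    by simp
  also have "\<dots> \<le> (\<integral>\<^sup>+x. (\<Prod>k\<in>J. ennreal (exp (g (x k)))) \<partial>(\<Pi>\<^sub>M k\<in>J. M))"
    by (intro nn_integral_mono)
       (auto simp: indicator_def prod_ennreal exp_sum[symmetric] J ennreal_le_iff
             simp flip: ennreal_1)
  also have "\<dots> = (\<Prod>k\<in>J. \<integral>\<^sup>+x. ennreal (exp (g x)) \<partial>M)"
    using J by (intro PS.product_nn_integral_prod) auto
  also have "\<dots> = ennreal ((\<integral>x. exp (g x) \<partial>M) ^ card J)"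
    using int by (simp add: nn_integral_eq_integral ennreal_power)
  finally show ?thesis
    by (simp add: PJ.emeasure_eq_measure ennreal_le_iff)
qed

text \<open>\<open>A J\<close> is the rejection region: for every \<open>S\<close> in
  \<open>W\<close> the average of the bounded exponent \<open>h S\<close> must reach
  \<open>r\<close>. Under \<open>S\<close> its probability is bounded through the constraint for
  that \<open>S\<close> alone, using that \<open>exp (h S)\<close> has mean at most 1. Under
  \<open>Q\<close> each constraint fails with exponentially small probability, and a union bound
  over \<open>W\<close> finishes.\<close>

lemma stein_test:
  fixes M Q :: "'a measure" and W :: "'a measure set" and r :: real
  assumes W: "finite W" "\<And>S. S \<in> W \<Longrightarrow> prob_space S" "\<And>S. S \<in> W \<Longrightarrow> sets S = sets M"
    and Q: "prob_space Q" "sets Q = sets M"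
    and r: "\<And>S. S \<in> W \<Longrightarrow> ereal r < relative_entropy Q S"
  obtains \<rho> :: "'a measure \<Rightarrow> real" and A :: "'i set \<Rightarrow> ('i \<Rightarrow> 'a) set" where
    "\<And>S. S \<in> W \<Longrightarrow> 0 \<le> \<rho> S \<and> \<rho> S < 1"
    "\<And>J. A J \<in> sets (\<Pi>\<^sub>M k\<in>J. M)"
    "\<And>J S. finite J \<Longrightarrow> S \<in> W \<Longrightarrow> measure (\<Pi>\<^sub>M k\<in>J. S) (A J) \<le> exp (- r * card J)"
    "\<And>J. finite J \<Longrightarrow> 1 - (\<Sum>S\<in>W. \<rho> S ^ card J) \<le> measure (\<Pi>\<^sub>M k\<in>J. Q) (A J)"
proof -
  interpret Q: prob_space Q by fact
  note [measurable_cong] = Q(2)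
  have "\<forall>S\<in>W. \<exists>h B t. h \<in> borel_measurable M \<and> (\<forall>x. \<bar>h x\<bar> \<le> (B::real)) \<and>
      (\<integral>x. exp (h x) \<partial>S) \<le> 1 \<and> 0 < t \<and> (\<integral>x. exp (- t * (h x - r)) \<partial>Q) < 1"
  proof
    fix S assume S: "S \<in> W"
    obtain h B where h: "h \<in> borel_measurable S" "\<And>x. \<bar>h x\<bar> \<le> (B::real)"
        "(\<integral>x. exp (h x) \<partial>S) \<le> 1" "r < (\<integral>x. h x \<partial>Q)"
      using less_relative_entropy_imp_bounded_exponent[OF W(2)[OF S] Q(1) _ r[OF S]] Q(2) W(3)[OF S] by auto
    have hM: "h \<in> borel_measurable M" "h \<in> borel_measurable Q"
      using h(1) Q(2) W(3)[OF S] by (simp_all cong: measurable_cong_sets)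
    obtain t where "t > 0" "(\<integral>x. exp (- t * (h x - r)) \<partial>Q) < 1"
      using Q.exponential_tilt[OF hM(2) h(2,4)] by blast
    then show "\<exists>h B t. h \<in> borel_measurable M \<and> (\<forall>x. \<bar>h x\<bar> \<le> (B::real)) \<and>
      (\<integral>x. exp (h x) \<partial>S) \<le> 1 \<and> 0 < t \<and> (\<integral>x. exp (- t * (h x - r)) \<partial>Q) < 1"
      using h hM by blast
  qed
  from bchoice[OF this] obtain h where "\<forall>S\<in>W. \<exists>B t. h S \<in> borel_measurable M \<and> (\<forall>x. \<bar>h S x\<bar> \<le> (B::real)) \<and>
      (\<integral>x. exp (h S x) \<partial>S) \<le> 1 \<and> 0 < t \<and> (\<integral>x. exp (- t * (h S x - r)) \<partial>Q) < 1" ..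
  from bchoice[OF this] obtain B where "\<forall>S\<in>W. \<exists>t. h S \<in> borel_measurable M \<and> (\<forall>x. \<bar>h S x\<bar> \<le> (B S::real)) \<and>
      (\<integral>x. exp (h S x) \<partial>S) \<le> 1 \<and> 0 < t \<and> (\<integral>x. exp (- t * (h S x - r)) \<partial>Q) < 1" ..
  from bchoice[OF this] obtain t where t: "\<forall>S\<in>W. h S \<in> borel_measurable M \<and> (\<forall>x. \<bar>h S x\<bar> \<le> (B S::real)) \<and>
      (\<integral>x. exp (h S x) \<partial>S) \<le> 1 \<and> 0 < t S \<and> (\<integral>x. exp (- t S * (h S x - r)) \<partial>Q) < 1" ..
  have h_meas[measurable]: "S \<in> W \<Longrightarrow> h S \<in> borel_measurable M" and hB: "S \<in> W \<Longrightarrow> \<bar>h S x\<bar> \<le> B S"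
    and hS: "S \<in> W \<Longrightarrow> (\<integral>x. exp (h S x) \<partial>S) \<le> 1"
    and tS: "S \<in> W \<Longrightarrow> 0 < t S" "S \<in> W \<Longrightarrow> (\<integral>x. exp (- t S * (h S x - r)) \<partial>Q) < 1" for S x
    using t by blast+
  have h_Q: "S \<in> W \<Longrightarrow> h S \<in> borel_measurable Q" for S by measurable
  define \<rho> where "\<rho> S = (\<integral>x. exp (- t S * (h S x - r)) \<partial>Q)" for S
  define A :: "'i set \<Rightarrow> ('i \<Rightarrow> 'a) set" where
    "A J = {x \<in> space (\<Pi>\<^sub>M k\<in>J. M). \<forall>S\<in>W. 0 \<le> (\<Sum>k\<in>J. h S (x k) - r)}" for J
  have A[measurable]: "A J \<in> sets (\<Pi>\<^sub>M k\<in>J. M)" for J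
    unfolding A_def using W(1) by measurable
  show thesis
  proof (rule that)
    show "0 \<le> \<rho> S \<and> \<rho> S < 1" if "S \<in> W" for S
      using tS(2)[OF that] by (auto simp: \<rho>_def intro!: integral_nonneg_AE)
    show "A J \<in> sets (\<Pi>\<^sub>M k\<in>J. M)" for J by (rule A)
  next
    fix J :: "'i set" and S assume J: "finite J" and S: "S \<in> W"
    interpret S: prob_space S using W(2)[OF S] .
    interpret PJ: prob_space "\<Pi>\<^sub>M k\<in>J. S" by (intro prob_space_PiM S.prob_space_axioms)
    note [measurable_cong] = W(3)[OF S]
    have [measurable]: "h S \<in> borel_measurable M" using S by measurable
    have int: "integrable S (\<lambda>x. exp (h S x))"
    proof (rule S.integrable_const_bound[where B="exp (B S)"])
      have "h S x \<le> B S" for x using hB[OF S, of x] by simp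
      then show "AE x in S. norm (exp (h S x)) \<le> exp (B S)" by simp
    qed measurable
    have sub: "A J \<subseteq> {x \<in> space (\<Pi>\<^sub>M k\<in>J. S). 0 \<le> (\<Sum>k\<in>J. h S (x k) - r)}"
      using S sets_eq_imp_space_eq[OF W(3)[OF S]] by (auto simp: A_def space_PiM)
    have "measure (\<Pi>\<^sub>M k\<in>J. S) (A J)
        \<le> measure (\<Pi>\<^sub>M k\<in>J. S) {x \<in> space (\<Pi>\<^sub>M k\<in>J. S). 0 \<le> (\<Sum>k\<in>J. h S (x k) - r)}"
      using sub by (rule PJ.finite_measure_mono) measurable
    also have "\<dots> \<le> (\<integral>x. exp (h S x - r) \<partial>S) ^ card J"
    proof (rule S.chernoff_product[OF _ _ J])
      show "\<bar>h S x - r\<bar> \<le> B S + \<bar>r\<bar>" for x using hB[OF S, of x] by linarith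
    qed measurable
    also have "(\<integral>x. exp (h S x - r) \<partial>S) = exp (- r) * (\<integral>x. exp (h S x) \<partial>S)"
      by (simp add: exp_diff exp_minus field_simps)
    also have "(exp (- r) * (\<integral>x. exp (h S x) \<partial>S)) ^ card J \<le> (exp (- r)) ^ card J"
      using hS[OF S] by (intro power_mono) (auto intro!: integral_nonneg_AE)
    finally show "measure (\<Pi>\<^sub>M k\<in>J. S) (A J) \<le> exp (- r * card J)"
      by (simp add: exp_of_nat_mult[symmetric] mult.commute)
  next
    fix J :: "'i set" assume J: "finite J"
    interpret PJ: prob_space "\<Pi>\<^sub>M k\<in>J. Q" by (intro prob_space_PiM Q.prob_space_axioms)
    \<comment> \<open>Failure of the constraint for \<open>S\<close>, with the inequality relaxed to
      a weak one and scaled by \<open>- t S\<close>, so that its Chernoff factor is exactly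
      \<open>\<rho> S\<close>.\<close>
    define N where "N S = {x \<in> space (\<Pi>\<^sub>M k\<in>J. Q). 0 \<le> (\<Sum>k\<in>J. - t S * (h S (x k) - r))}" for S
    have N[measurable]: "N S \<in> sets (\<Pi>\<^sub>M k\<in>J. Q)" if "S \<in> W" for S
      unfolding N_def using that by measurable
    have AQ: "A J \<in> sets (\<Pi>\<^sub>M k\<in>J. Q)" by measurable
    have "space (\<Pi>\<^sub>M k\<in>J. Q) - A J \<subseteq> (\<Union>S\<in>W. N S)"
    proof
      fix x assume x: "x \<in> space (\<Pi>\<^sub>M k\<in>J. Q) - A J"
      then have "x \<in> space (\<Pi>\<^sub>M k\<in>J. M)" using sets_eq_imp_space_eq[OF Q(2)] by (auto simp: space_PiM)
      with x obtain S where S: "S \<in> W" "(\<Sum>k\<in>J. h S (x k) - r) < 0" by (auto simp: A_def)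
      have "0 \<le> - t S * (\<Sum>k\<in>J. h S (x k) - r)"
        using S tS(1)[OF S(1)] by (simp add: mult_le_0_iff)
      then have "x \<in> N S" using x by (simp add: N_def sum_distrib_left)
      then show "x \<in> (\<Union>S\<in>W. N S)" using S by blast
    qed
    then have "measure (\<Pi>\<^sub>M k\<in>J. Q) (space (\<Pi>\<^sub>M k\<in>J. Q) - A J) \<le> measure (\<Pi>\<^sub>M k\<in>J. Q) (\<Union>S\<in>W. N S)"
      using N W(1) by (intro PJ.finite_measure_mono) auto
    also have "\<dots> \<le> (\<Sum>S\<in>W. measure (\<Pi>\<^sub>M k\<in>J. Q) (N S))"
      using N W(1) by (intro PJ.finite_measure_subadditive_finite) auto
    also have "\<dots> \<le> (\<Sum>S\<in>W. \<rho> S ^ card J)"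
    proof (rule sum_mono)
      fix S assume S: "S \<in> W"
      have [measurable]: "h S \<in> borel_measurable Q" using S by measurable
      show "measure (\<Pi>\<^sub>M k\<in>J. Q) (N S) \<le> \<rho> S ^ card J"
        unfolding N_def \<rho>_def
      proof (rule Q.chernoff_product[OF _ _ J])
        have "\<bar>h S x - r\<bar> \<le> B S + \<bar>r\<bar>" for x using hB[OF S, of x] by linarith
        then show "\<bar>- t S * (h S x - r)\<bar> \<le> t S * (B S + \<bar>r\<bar>)" for x
          using tS(1)[OF S] by (simp add: abs_mult)
      qed measurable
    qed
    finally show "1 - (\<Sum>S\<in>W. \<rho> S ^ card J) \<le> measure (\<Pi>\<^sub>M k\<in>J. Q) (A J)"
      using PJ.prob_compl[OF AQ] by simp
  qed
qed

section \<open>Making the sizes equal\<close>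

text \<open>Lagrange interpolation in a product: spending one coordinate per competitor \<open>S \<noteq> R\<close> on a
  centred separating indicator makes the product integrate to exactly \<open>0\<close> under \<open>S\<close> and \<open>1\<close> under \<open>R\<close>.\<close>

lemma dual_statistics:
  fixes M :: "'a measure" and W :: "'a measure set"
  assumes W: "finite W" "\<And>S. S \<in> W \<Longrightarrow> prob_space S" "\<And>S. S \<in> W \<Longrightarrow> sets S = sets M"
  obtains C :: real where "C \<ge> 0"
    "\<And>J :: 'i set. finite J \<Longrightarrow> card W \<le> card J \<Longrightarrow>
       \<exists>H :: 'a measure \<Rightarrow> ('i \<Rightarrow> 'a) \<Rightarrow> real. \<forall>R\<in>W. H R \<in> borel_measurable (\<Pi>\<^sub>M k\<in>J. M) \<and> (\<forall>x. \<bar>H R x\<bar> \<le> C) \<and>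
         (\<forall>S\<in>W. (\<integral>x. H R x \<partial>(\<Pi>\<^sub>M k\<in>J. S)) = of_bool (R = S))"
proof -
  have "\<exists>g B. g \<in> borel_measurable M \<and> (\<forall>x. \<bar>g x\<bar> \<le> (B::real)) \<and> (\<integral>x. g x \<partial>R) = 1 \<and> (\<integral>x. g x \<partial>S) = 0"
    if RS: "R \<in> W" "S \<in> W" "R \<noteq> S" for R S
  proof -
    interpret R: prob_space R using W(2)[OF RS(1)] .
    interpret S: prob_space S using W(2)[OF RS(2)] .
    note [measurable_cong] = W(3)[OF RS(1)] W(3)[OF RS(2)]
    obtain D where D[measurable]: "D \<in> sets M" and neq: "measure R D \<noteq> measure S D"
      using measure_eqI[of R S] RS W(3) by (auto simp: R.emeasure_eq_measure S.emeasure_eq_measure)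
    define d where "d = measure R D - measure S D"
    have d: "d \<noteq> 0" using neq by (simp add: d_def)
    \<comment> \<open>Subtracting \<open>measure S D\<close> makes the mean under \<open>S\<close>
      zero, and dividing by the difference \<open>d\<close> makes the mean under \<open>R\<close>
      one.\<close>
    define g where "g x = (indicator D x - measure S D) / d" for x
    have "\<bar>g x\<bar> \<le> 1 / \<bar>d\<bar>" for x
      using S.prob_le_1[of D] by (auto simp: g_def abs_divide indicator_def intro!: divide_right_mono)
    moreover have "(\<integral>x. g x \<partial>R) = 1" "(\<integral>x. g x \<partial>S) = 0"
      using d by (simp_all add: g_def R.prob_space S.prob_space R.emeasure_eq_measure S.emeasure_eq_measure d_def[symmetric])
    moreover have "g \<in> borel_measurable M" unfolding g_def by measurable
    ultimately show ?thesis by blast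
  qed
  then obtain g B where gB: "\<And>R S. R \<in> W \<Longrightarrow> S \<in> W \<Longrightarrow> R \<noteq> S \<Longrightarrow>
      g R S \<in> borel_measurable M \<and> (\<forall>x. \<bar>g R S x\<bar> \<le> (B R S::real)) \<and> (\<integral>x. g R S x \<partial>R) = 1 \<and> (\<integral>x. g R S x \<partial>S) = 0"
    by metis
  define b where "b = 1 + (\<Sum>(R, S)\<in>W \<times> W. \<bar>B R S\<bar>)"
  have b1: "b \<ge> 1" by (auto simp: b_def intro!: sum_nonneg)
  have gb: "\<bar>g R S x\<bar> \<le> b" if "R \<in> W" "S \<in> W" "R \<noteq> S" for R S x
  proof -
    have "\<bar>g R S x\<bar> \<le> \<bar>B R S\<bar>" using gB[OF that] by (meson abs_ge_self order_trans)
    also have "\<dots> \<le> (\<Sum>(R, S)\<in>W \<times> W. \<bar>B R S\<bar>)"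
      using member_le_sum[of "(R, S)" "W \<times> W" "\<lambda>(R, S). \<bar>B R S\<bar>"] that W(1) by auto
    finally show ?thesis by (simp add: b_def)
  qed
  show thesis
  proof (rule that[of "b ^ card W"])
    fix J :: "'i set" assume J: "finite J" "card W \<le> card J"
    \<comment> \<open>The coordinate \<open>e S\<close> is reserved for excluding \<open>S\<close>.
      Injectivity keeps the coordinates of different competitors apart, and
      \<open>card W \<le> card J\<close> makes room for them.\<close>
    obtain e where e: "e ` W \<subseteq> J" "inj_on e W"
      using card_le_inj[OF W(1) J] by blast
    define G where "G R j = (if j \<in> e ` (W - {R}) then g R (inv_into W e j) else (\<lambda>_. 1))" for R j
    define H where "H R x = (\<Prod>j\<in>J. G R j (x j))" for R x
    have G_e: "G R (e S) = g R S" if "R \<in> W" "S \<in> W" "R \<noteq> S" for R S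
      using that e(2) by (auto simp: G_def inv_into_f_f)
    have G_cases: "(\<exists>S\<in>W. S \<noteq> R \<and> j = e S \<and> G R j = g R S) \<or> (G R j = (\<lambda>_. 1) \<and> j \<notin> e ` (W - {R}))" if "R \<in> W" for R j
      using G_e[OF that] by (auto simp: G_def)
    have G_meas: "G R j \<in> borel_measurable M" if "R \<in> W" for R j
      using G_cases[OF that, of j] gB[OF that] by auto
    have G_bnd: "\<bar>G R j x\<bar> \<le> b" if "R \<in> W" for R j x
      using G_cases[OF that, of j] gb[OF that] b1 by fastforce
    have G_R: "(\<integral>x. G R j x \<partial>R) = 1" if "R \<in> W" for R j
      using G_cases[OF that, of j] gB[OF that] prob_space.prob_space[OF W(2)[OF that]] by auto
    have H_int: "(\<integral>x. H R x \<partial>(\<Pi>\<^sub>M k\<in>J. S)) = (\<Prod>j\<in>J. \<integral>x. G R j x \<partial>S)" if "R \<in> W" "S \<in> W" for R S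
    proof -
      interpret S: prob_space S using W(2)[OF that(2)] .
      interpret PS: product_prob_space "\<lambda>_. S" by standard
      have GS: "G R j \<in> borel_measurable S" for j
        using G_meas[OF that(1)] W(3)[OF that(2)] by (simp cong: measurable_cong_sets)
      show ?thesis
        unfolding H_def using J(1) G_bnd[OF that(1)]
        by (intro PS.product_integral_prod S.integrable_const_bound[where B=b] GS) auto
    qed
    show "\<exists>H. \<forall>R\<in>W. H R \<in> borel_measurable (\<Pi>\<^sub>M k\<in>J. M) \<and> (\<forall>x. \<bar>H R x\<bar> \<le> b ^ card W) \<and>
         (\<forall>S\<in>W. (\<integral>x. H R x \<partial>(\<Pi>\<^sub>M k\<in>J. S)) = of_bool (R = S))"
    proof (intro exI[of _ H] ballI conjI allI)
      fix R assume R: "R \<in> W"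
      show "H R \<in> borel_measurable (\<Pi>\<^sub>M k\<in>J. M)"
        unfolding H_def using G_meas[OF R] by measurable
      show "\<bar>H R x\<bar> \<le> b ^ card W" for x
      proof -
        \<comment> \<open>All other factors are 1, so the bound depends on the number of measures
          and not on the sample size.\<close>
        have "H R x = (\<Prod>j\<in>e ` (W - {R}). G R j (x j))"
          unfolding H_def using J(1) e(1)
          by (intro prod.mono_neutral_right ballI) (auto simp: G_def)
        then have "\<bar>H R x\<bar> = (\<Prod>j\<in>e ` (W - {R}). \<bar>G R j (x j)\<bar>)"
          by (simp add: abs_prod)
        also have "\<dots> \<le> (\<Prod>j\<in>e ` (W - {R}). b)"
          by (intro prod_mono) (auto intro: G_bnd[OF R])
        also have "\<dots> = b ^ card (e ` (W - {R}))" by simp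
        also have "\<dots> \<le> b ^ card W"
          using b1 W(1) card_image_le[of "W - {R}" e] card_mono[of W "W - {R}"]
          by (intro power_increasing) auto
        finally show ?thesis .
      qed
      fix S assume S: "S \<in> W"
      show "(\<integral>x. H R x \<partial>(\<Pi>\<^sub>M k\<in>J. S)) = of_bool (R = S)"
      proof (cases "R = S")
        case True
        then show ?thesis using H_int[OF R R] G_R[OF R] by simp
      next
        case False
        then have "(\<integral>x. G R (e S) x \<partial>S) = 0" "e S \<in> J"
          using G_e[OF R S] gB[OF R S] e(1) S by auto
        then have "(\<Prod>j\<in>J. \<integral>x. G R j x \<partial>S) = 0"
          using J(1) by (intro prod_zero) auto
        then show ?thesis using False H_int[OF R S] by simp
      qed
    qed
  qed (use b1 in simp)
qed

text \<open>Subtracting from the indicator of the Stein region the combination \<open>T\<close> of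
  dual statistics, weighted by the sizes of that region, removes the size under every
  \<open>S\<close> in \<open>W\<close>. Adding a constant and rescaling gives a test function with
  one common size. As \<open>T\<close> is of the order of the sizes themselves, neither the exponent
  \<open>r\<close> nor the limiting power is lost.\<close>

lemma similar_test:
  fixes M Q :: "'a measure" and W :: "'a measure set" and r :: real
  assumes W: "finite W" "\<And>S. S \<in> W \<Longrightarrow> prob_space S" "\<And>S. S \<in> W \<Longrightarrow> sets S = sets M"
    and Q: "prob_space Q" "sets Q = sets M"
    and r: "\<And>S. S \<in> W \<Longrightarrow> ereal r < relative_entropy Q S"
  obtains \<rho> :: "'a measure \<Rightarrow> real" and C :: real where
    "\<And>S. S \<in> W \<Longrightarrow> 0 \<le> \<rho> S \<and> \<rho> S < 1" "C > 0"
    "\<And>J :: 'i set. finite J \<Longrightarrow> card W \<le> card J \<Longrightarrow>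
       \<exists>\<phi> \<alpha>. \<phi> \<in> borel_measurable (\<Pi>\<^sub>M k\<in>J. M) \<and> (\<forall>x. 0 < \<phi> x \<and> \<phi> x < 1) \<and>
         0 < \<alpha> \<and> \<alpha> \<le> C * exp (- r * card J) \<and>
         (\<forall>S\<in>W. (\<integral>x. \<phi> x \<partial>(\<Pi>\<^sub>M k\<in>J. S)) = \<alpha>) \<and>
         (1 - (\<Sum>S\<in>W. \<rho> S ^ card J)) / (1 + 2 * C * exp (- r * card J)) \<le> (\<integral>x. \<phi> x \<partial>(\<Pi>\<^sub>M k\<in>J. Q))"
proof -
  obtain \<rho> and A :: "'i set \<Rightarrow> ('i \<Rightarrow> 'a) set" where
    rho: "\<And>S. S \<in> W \<Longrightarrow> 0 \<le> \<rho> S \<and> \<rho> S < 1"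
    and A: "\<And>J. A J \<in> sets (\<Pi>\<^sub>M k\<in>J. M)"
    and AW: "\<And>J S. finite J \<Longrightarrow> S \<in> W \<Longrightarrow> measure (\<Pi>\<^sub>M k\<in>J. S) (A J) \<le> exp (- r * card J)"
    and AQ: "\<And>J. finite J \<Longrightarrow> 1 - (\<Sum>S\<in>W. \<rho> S ^ card J) \<le> measure (\<Pi>\<^sub>M k\<in>J. Q) (A J)"
    using stein_test[of W M Q r, OF W Q r] by blast
  obtain C0 where C0: "C0 \<ge> 0" and
    dual: "\<And>J :: 'i set. finite J \<Longrightarrow> card W \<le> card J \<Longrightarrow>
       \<exists>H :: 'a measure \<Rightarrow> ('i \<Rightarrow> 'a) \<Rightarrow> real. \<forall>R\<in>W. H R \<in> borel_measurable (\<Pi>\<^sub>M k\<in>J. M) \<and> (\<forall>x. \<bar>H R x\<bar> \<le> C0) \<and>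
         (\<forall>S\<in>W. (\<integral>x. H R x \<partial>(\<Pi>\<^sub>M k\<in>J. S)) = of_bool (R = S))"
    using dual_statistics[OF W] by metis
  \<comment> \<open>\<open>C - 1\<close> bounds \<open>T\<close> in units of \<epsilon>. The extra 1
    keeps \<open>\<phi>\<close> strictly between 0 and 1, the range of levels in which the uniform
    randomizer is controlled.\<close>
  define C where "C = card W * C0 + 1"
  have C: "C > 0" using C0 by (simp add: C_def add_nonneg_pos)
  show thesis
  proof (rule that[OF rho C])
    fix J :: "'i set" assume J: "finite J" "card W \<le> card J"
    obtain H :: "'a measure \<Rightarrow> ('i \<Rightarrow> 'a) \<Rightarrow> real" where
      H[measurable]: "\<And>R. R \<in> W \<Longrightarrow> H R \<in> borel_measurable (\<Pi>\<^sub>M k\<in>J. M)"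
      and HC: "\<And>R x. R \<in> W \<Longrightarrow> \<bar>H R x\<bar> \<le> C0"
      and H_int: "\<And>R S. R \<in> W \<Longrightarrow> S \<in> W \<Longrightarrow> (\<integral>x. H R x \<partial>(\<Pi>\<^sub>M k\<in>J. S)) = of_bool (R = S)"
      using dual[OF J] by blast
    define \<epsilon> where "\<epsilon> = exp (- r * card J)"
    have eps: "\<epsilon> > 0" by (simp add: \<epsilon>_def)
    define v where "v R = measure (\<Pi>\<^sub>M k\<in>J. R) (A J)" for R
    have v: "0 \<le> v R" "R \<in> W \<Longrightarrow> v R \<le> \<epsilon>" for R
      using AW[OF J(1)] by (auto simp: v_def \<epsilon>_def)
    define T where "T x = (\<Sum>R\<in>W. v R * H R x)" for x
    have T_bnd: "\<bar>T x\<bar> \<le> \<epsilon> * (C - 1)" for x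
    proof -
      have "\<bar>T x\<bar> \<le> (\<Sum>R\<in>W. \<bar>v R * H R x\<bar>)" unfolding T_def by (rule sum_abs)
      also have "\<dots> \<le> (\<Sum>R\<in>W. \<epsilon> * C0)"
        using v HC eps by (intro sum_mono) (auto simp: abs_mult intro!: mult_mono)
      finally show ?thesis by (simp add: C_def algebra_simps)
    qed
    have T_meas: "T \<in> borel_measurable (\<Pi>\<^sub>M k\<in>J. M)"
      unfolding T_def by measurable
    \<comment> \<open>The numerator of \<open>\<phi>\<close> is below
      \<open>1 + 2 * C * \<epsilon>\<close>, because the shift and \<open>- T\<close> each
      contribute at most \<open>C * \<epsilon>\<close>.\<close>
    define Z where "Z = 1 + 2 * C * \<epsilon>"
    have Z: "Z > 0" using C eps by (simp add: Z_def add_pos_pos)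
    define \<phi> where "\<phi> x = (indicator (A J) x + \<epsilon> * C - T x) / Z" for x
    have phi_meas: "\<phi> \<in> borel_measurable (\<Pi>\<^sub>M k\<in>J. M)"
      unfolding \<phi>_def using T_meas A[of J] by measurable
    have phi_bnd: "0 < \<phi> x \<and> \<phi> x < 1" for x
    proof -
      have "\<epsilon> * (C - 1) = \<epsilon> * C - \<epsilon>" by (simp add: algebra_simps)
      moreover have "(0::real) \<le> indicator (A J) x" "indicator (A J) x \<le> (1::real)"
        by (auto simp: indicator_def)
      moreover have "2 * C * \<epsilon> = \<epsilon> * C + \<epsilon> * C" by simp
      ultimately have "0 < indicator (A J) x + \<epsilon> * C - T x" "indicator (A J) x + \<epsilon> * C - T x < Z"
        using T_bnd[of x] eps unfolding Z_def abs_le_iff by linarith+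
      then show ?thesis using Z by (simp add: \<phi>_def)
    qed
    have int_phi: "(\<integral>x. \<phi> x \<partial>(\<Pi>\<^sub>M k\<in>J. S)) =
        (measure (\<Pi>\<^sub>M k\<in>J. S) (A J) + \<epsilon> * C - (\<integral>x. T x \<partial>(\<Pi>\<^sub>M k\<in>J. S))) / Z"
      if "prob_space S" "sets S = sets M" for S
    proof -
      interpret PJ: prob_space "\<Pi>\<^sub>M k\<in>J. S" using that by (intro prob_space_PiM)
      have sets: "sets (\<Pi>\<^sub>M k\<in>J. S) = sets (\<Pi>\<^sub>M k\<in>J. M)"
        using that by (intro sets_PiM_cong) auto
      have "integrable (\<Pi>\<^sub>M k\<in>J. S) T"
        using T_bnd T_meas sets by (intro PJ.integrable_const_bound[where B="\<epsilon> * (C - 1)"]) (auto cong: measurable_cong_sets)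
      moreover have "A J \<in> sets (\<Pi>\<^sub>M k\<in>J. S)" using A sets by simp
      ultimately show ?thesis
        by (simp add: \<phi>_def PJ.prob_space PJ.emeasure_eq_measure)
    qed
    define \<alpha> where "\<alpha> = \<epsilon> * C / Z"
    have int_T: "(\<integral>x. T x \<partial>(\<Pi>\<^sub>M k\<in>J. S)) = v S" if S: "S \<in> W" for S
    proof -
      interpret PJ: prob_space "\<Pi>\<^sub>M k\<in>J. S" using W(2)[OF S] by (intro prob_space_PiM)
      have sets: "sets (\<Pi>\<^sub>M k\<in>J. S) = sets (\<Pi>\<^sub>M k\<in>J. M)"
        using W(3)[OF S] by (intro sets_PiM_cong) auto
      have "integrable (\<Pi>\<^sub>M k\<in>J. S) (H R)" if "R \<in> W" for R
        using HC H sets that by (intro PJ.integrable_const_bound[where B=C0]) (auto cong: measurable_cong_sets)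
      then have "(\<integral>x. T x \<partial>(\<Pi>\<^sub>M k\<in>J. S)) = (\<Sum>R\<in>W. v R * of_bool (R = S))"
        unfolding T_def using H_int S by (simp add: Bochner_Integration.integral_sum cong: sum.cong)
      also have "\<dots> = v S"
        using W(1) S by (simp add: of_bool_def if_distrib[of "\<lambda>c. v _ * c"] cong: if_cong)
      finally show ?thesis .
    qed
    have alpha: "0 < \<alpha>" "\<alpha> \<le> C * \<epsilon>"
      using eps C Z by (auto simp: \<alpha>_def Z_def field_simps)
    have Q_phi: "(1 - (\<Sum>S\<in>W. \<rho> S ^ card J)) / Z \<le> (\<integral>x. \<phi> x \<partial>(\<Pi>\<^sub>M k\<in>J. Q))"
    proof -
      interpret PJ: prob_space "\<Pi>\<^sub>M k\<in>J. Q" using Q by (intro prob_space_PiM)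
      have sets: "sets (\<Pi>\<^sub>M k\<in>J. Q) = sets (\<Pi>\<^sub>M k\<in>J. M)"
        using Q by (intro sets_PiM_cong) auto
      \<comment> \<open>The mean of \<open>T\<close> under \<open>Q\<close> is not computed. The
        shift \<open>\<epsilon> * C\<close> dominates it, so only the division by \<open>Z\<close>
        costs power.\<close>
      have "(\<integral>x. T x \<partial>(\<Pi>\<^sub>M k\<in>J. Q)) \<le> (\<integral>x. \<epsilon> * (C - 1) \<partial>(\<Pi>\<^sub>M k\<in>J. Q))"
      proof (rule integral_mono)
        show "integrable (\<Pi>\<^sub>M k\<in>J. Q) T"
          using T_bnd T_meas sets by (intro PJ.integrable_const_bound[where B="\<epsilon> * (C - 1)"]) (auto cong: measurable_cong_sets)
      qed (use T_bnd in \<open>auto simp: abs_le_iff\<close>)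
      also have "\<dots> \<le> \<epsilon> * C" using eps by (simp add: PJ.prob_space algebra_simps)
      finally show ?thesis
        unfolding int_phi[OF Q] using AQ[OF J(1)] Z by (intro divide_right_mono) auto
    qed
    show "\<exists>\<phi> \<alpha>. \<phi> \<in> borel_measurable (\<Pi>\<^sub>M k\<in>J. M) \<and> (\<forall>x. 0 < \<phi> x \<and> \<phi> x < 1) \<and>
         0 < \<alpha> \<and> \<alpha> \<le> C * exp (- r * card J) \<and>
         (\<forall>S\<in>W. (\<integral>x. \<phi> x \<partial>(\<Pi>\<^sub>M k\<in>J. S)) = \<alpha>) \<and>
         (1 - (\<Sum>S\<in>W. \<rho> S ^ card J)) / (1 + 2 * C * exp (- r * card J)) \<le> (\<integral>x. \<phi> x \<partial>(\<Pi>\<^sub>M k\<in>J. Q))"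
    proof (intro exI[of _ \<phi>] exI[of _ \<alpha>] conjI ballI)
      show "(\<integral>x. \<phi> x \<partial>(\<Pi>\<^sub>M k\<in>J. S)) = \<alpha>" if "S \<in> W" for S
        unfolding int_phi[OF W(2)[OF that] W(3)[OF that]] using int_T[OF that] by (simp add: v_def \<alpha>_def)
    qed (use phi_meas phi_bnd alpha Q_phi in \<open>simp_all add: \<epsilon>_def Z_def\<close>)
  qed
qed

section \<open>The upper bound\<close>

lemma enn2ereal_diff_eq_integral:
  fixes g :: "'a \<Rightarrow> real"
  assumes "integrable M g"
  shows "enn2ereal (\<integral>\<^sup>+x. ennreal (g x) \<partial>M) - enn2ereal (\<integral>\<^sup>+x. ennreal (- g x) \<partial>M) = ereal (\<integral>x. g x \<partial>M)"
proof -
  have "(\<integral>\<^sup>+x. ennreal (g x) \<partial>M) \<noteq> \<infinity>" "(\<integral>\<^sup>+x. ennreal (- g x) \<partial>M) \<noteq> \<infinity>"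
    using assms by (auto simp: real_integrable_def)
  then show ?thesis
    unfolding real_lebesgue_integral_def[OF assms]
    by (cases "\<integral>\<^sup>+x. ennreal (g x) \<partial>M"; cases "\<integral>\<^sup>+x. ennreal (- g x) \<partial>M") (auto simp: enn2ereal_ennreal)
qed

text \<open>The positive part of \<open>u\<close> is dominated by that of \<open>g\<close>, which
  has finite integral, so the difference defining \<open>ext_expectation\<close> is not
  \<open>\<infinity> - \<infinity>\<close> and is monotone in both parts.\<close>

lemma ext_expectation_le_integral:
  fixes g :: "'a \<Rightarrow> real"
  assumes g: "integrable M g" and le: "AE x in M. u x \<le> ereal (g x)"
  shows "ext_expectation M u \<le> ereal (\<integral>x. g x \<partial>M)"
proof -
  have "(\<integral>\<^sup>+x. e2ennreal (u x) \<partial>M) \<le> (\<integral>\<^sup>+x. ennreal (g x) \<partial>M)"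
    by (intro nn_integral_mono_AE, use le in eventually_elim) (metis e2ennreal_ereal e2ennreal_mono)
  moreover have "(\<integral>\<^sup>+x. ennreal (- g x) \<partial>M) \<le> (\<integral>\<^sup>+x. e2ennreal (- u x) \<partial>M)"
    by (intro nn_integral_mono_AE, use le in eventually_elim)
       (metis e2ennreal_ereal e2ennreal_mono ereal_minus_le_minus uminus_ereal.simps(1))
  ultimately show ?thesis
    unfolding ext_expectation_def enn2ereal_diff_eq_integral[OF g, symmetric]
    by (intro ereal_minus_mono) (auto simp: less_eq_ennreal.rep_eq)
qed

lemma ext_expectation_eq_integral:
  fixes g :: "'a \<Rightarrow> real"
  assumes "integrable M g" "\<And>x. x \<in> space M \<Longrightarrow> u x = ereal (g x)"
  shows "ext_expectation M u = ereal (\<integral>x. g x \<partial>M)"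
    and "ext_expectation_defined M u"
proof -
  have "(\<integral>\<^sup>+x. e2ennreal (u x) \<partial>M) = (\<integral>\<^sup>+x. ennreal (g x) \<partial>M)"
    "(\<integral>\<^sup>+x. e2ennreal (- u x) \<partial>M) = (\<integral>\<^sup>+x. ennreal (- g x) \<partial>M)"
    by (auto intro!: nn_integral_cong simp: assms(2) e2ennreal_ereal)
  moreover have "(\<integral>\<^sup>+x. ennreal (g x) \<partial>M) \<noteq> \<infinity>"
    using assms(1) by (auto simp: real_integrable_def)
  ultimately show "ext_expectation M u = ereal (\<integral>x. g x \<partial>M)" "ext_expectation_defined M u"
    using enn2ereal_diff_eq_integral[OF assms(1)]
    by (auto simp: ext_expectation_def ext_expectation_defined_def less_top[symmetric])
qed

lemma (in dominated_prob) density_PiM_lik: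
  fixes J :: "'i set"
  assumes J: "finite J"
  shows "density (\<Pi>\<^sub>M k\<in>J. P) (\<lambda>x. \<Prod>k\<in>J. ennreal (lik (x k))) = (\<Pi>\<^sub>M k\<in>J. Q)"
proof -
  interpret PQ: product_prob_space "\<lambda>_ :: 'i. Q" by standard
  interpret PP: product_prob_space "\<lambda>_ :: 'i. P" by standard
  have sets: "sets (\<Pi>\<^sub>M k\<in>J. P) = sets (\<Pi>\<^sub>M k\<in>J. Q)"
    using sets_eq by (intro sets_PiM_cong) auto
  show ?thesis
  proof (rule PQ.PiM_eqI[OF J])
    fix A assume "\<And>i. i \<in> J \<Longrightarrow> A i \<in> sets Q"
    then have A[measurable]: "\<And>i. i \<in> J \<Longrightarrow> A i \<in> sets P" using sets_eq by simp
    have PA: "Pi\<^sub>E J A \<in> sets (\<Pi>\<^sub>M k\<in>J. P)" using A J by (intro sets_PiM_I_finite) auto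
    have "emeasure (density (\<Pi>\<^sub>M k\<in>J. P) (\<lambda>x. \<Prod>k\<in>J. ennreal (lik (x k)))) (Pi\<^sub>E J A)
        = (\<integral>\<^sup>+x. (\<Prod>k\<in>J. ennreal (lik (x k))) * indicator (Pi\<^sub>E J A) x \<partial>(\<Pi>\<^sub>M k\<in>J. P))"
      using PA by (intro emeasure_density) auto
    also have "\<dots> = (\<integral>\<^sup>+x. (\<Prod>k\<in>J. ennreal (lik (x k)) * indicator (A k) (x k)) \<partial>(\<Pi>\<^sub>M k\<in>J. P))"
    proof (rule nn_integral_cong)
      fix x assume "x \<in> space (\<Pi>\<^sub>M k\<in>J. P)"
      \<comment> \<open>Membership in the box also demands extensionality, which holds on the whole
        product space; only then is its indicator the product of the coordinate indicators.\<close>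
      then have "x \<in> extensional J" by (auto simp: space_PiM PiE_def)
      then have "indicator (Pi\<^sub>E J A) x = (\<Prod>k\<in>J. indicator (A k) (x k) :: ennreal)"
        using J by (auto simp: indicator_def PiE_def Pi_def prod_zero_iff)
      then show "(\<Prod>k\<in>J. ennreal (lik (x k))) * indicator (Pi\<^sub>E J A) x = (\<Prod>k\<in>J. ennreal (lik (x k)) * indicator (A k) (x k))"
        by (simp add: prod.distrib)
    qed
    also have "\<dots> = (\<Prod>k\<in>J. \<integral>\<^sup>+x. ennreal (lik x) * indicator (A k) x \<partial>P)"
      using J by (intro PP.product_nn_integral_prod[of J "\<lambda>k y. ennreal (lik y) * indicator (A k) y"]) auto
    also have "\<dots> = (\<Prod>k\<in>J. emeasure (density P (\<lambda>x. ennreal (lik x))) (A k))"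
      by (intro prod.cong refl) (simp add: emeasure_density)
    finally show "emeasure (density (\<Pi>\<^sub>M k\<in>J. P) (\<lambda>x. \<Prod>k\<in>J. ennreal (lik (x k)))) (Pi\<^sub>E J A)
        = (\<Prod>k\<in>J. emeasure Q (A k))" by (simp add: density_lik)
  qed (simp add: sets)
qed

lemma (in dominated_prob) integrable_ln_lik:
  assumes "relative_entropy Q P = ereal D"
  shows "integrable Q (\<lambda>x. ln (lik x))" "(\<integral>x. ln (lik x) \<partial>Q) = D"
proof -
  have meas: "(\<lambda>x. ln (lik x)) \<in> borel_measurable Q"
    using borel_measurable_ln[OF borel_measurable_lik] sets_eq by (simp cong: measurable_cong_sets)
  have "(\<integral>\<^sup>+x. ennreal (- ln (lik x)) \<partial>Q) \<noteq> \<infinity>"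
    using neg_part_finite by (auto simp: top_unique)
  moreover from this have "(\<integral>\<^sup>+x. ennreal (ln (lik x)) \<partial>Q) \<noteq> \<infinity>"
    using assms unfolding relative_entropy_lik by (cases "\<integral>\<^sup>+x. ennreal (- ln (lik x)) \<partial>Q") (auto simp: enn2ereal_ennreal)
  ultimately show "integrable Q (\<lambda>x. ln (lik x))"
    using meas by (simp add: real_integrable_def)
  then show "(\<integral>x. ln (lik x) \<partial>Q) = D"
    using assms enn2ereal_diff_eq_integral unfolding relative_entropy_lik by force
qed

lemma (in dominated_prob) ext_expectation_eln_le:
  fixes D :: real
  assumes D: "relative_entropy Q P = ereal D" and J: "finite J"
    and E[measurable]: "E \<in> borel_measurable (\<Pi>\<^sub>M k\<in>J. P)" and E_int: "(\<integral>\<^sup>+x. ennreal (E x) \<partial>(\<Pi>\<^sub>M k\<in>J. P)) \<le> 1"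
    and E_nonneg: "\<And>x. x \<in> space (\<Pi>\<^sub>M k\<in>J. P) \<Longrightarrow> 0 \<le> E x"
  shows "ext_expectation (\<Pi>\<^sub>M k\<in>J. Q) (\<lambda>x. eln (ennreal (E x))) \<le> ereal (card J * D)"
proof -
  interpret QJ: prob_space "\<Pi>\<^sub>M k\<in>J. Q" by (intro prob_space_PiM Q.prob_space_axioms)
  have sets: "sets (\<Pi>\<^sub>M k\<in>J. P) = sets (\<Pi>\<^sub>M k\<in>J. Q)"
    using sets_eq by (intro sets_PiM_cong) auto
  note sp = sets_eq_imp_space_eq[OF sets]
  define \<Lambda> where "\<Lambda> x = (\<Prod>k\<in>J. lik (x k))" for x
  have \<Lambda>_nonneg: "\<Lambda> x \<ge> 0" for x by (simp add: \<Lambda>_def lik_nonneg prod_nonneg)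
  have \<Lambda>_meas[measurable]: "\<Lambda> \<in> borel_measurable (\<Pi>\<^sub>M k\<in>J. P)"
    unfolding \<Lambda>_def by measurable
  have dens: "(\<Pi>\<^sub>M k\<in>J. Q) = density (\<Pi>\<^sub>M k\<in>J. P) (\<lambda>x. ennreal (\<Lambda> x))"
    by (simp add: density_PiM_lik[OF J, symmetric] \<Lambda>_def prod_ennreal lik_nonneg)
  have ratio: "(\<integral>\<^sup>+x. ennreal (E x / \<Lambda> x) \<partial>(\<Pi>\<^sub>M k\<in>J. Q)) \<le> 1"
  proof -
    have "(\<integral>\<^sup>+x. ennreal (E x / \<Lambda> x) \<partial>(\<Pi>\<^sub>M k\<in>J. Q)) = (\<integral>\<^sup>+x. ennreal (\<Lambda> x) * ennreal (E x / \<Lambda> x) \<partial>(\<Pi>\<^sub>M k\<in>J. P))"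
      unfolding dens by (rule nn_integral_density) measurable
    \<comment> \<open>Only an inequality: where \<open>\<Lambda> x = 0\<close> the left integrand is
      0 while \<open>E x\<close> may be positive.\<close>
    also have "\<dots> \<le> (\<integral>\<^sup>+x. ennreal (E x) \<partial>(\<Pi>\<^sub>M k\<in>J. P))"
      using \<Lambda>_nonneg by (intro nn_integral_mono) (auto simp: ennreal_mult'[symmetric] divide_simps)
    also note E_int
    finally show ?thesis .
  qed
  have ratio_int: "integrable (\<Pi>\<^sub>M k\<in>J. Q) (\<lambda>x. E x / \<Lambda> x)" "(\<integral>x. E x / \<Lambda> x \<partial>(\<Pi>\<^sub>M k\<in>J. Q)) \<le> 1"
  proof -
    have meas: "(\<lambda>x. E x / \<Lambda> x) \<in> borel_measurable (\<Pi>\<^sub>M k\<in>J. Q)"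
      unfolding measurable_cong_sets[OF sets[symmetric] refl] by measurable
    have nonneg: "AE x in (\<Pi>\<^sub>M k\<in>J. Q). 0 \<le> E x / \<Lambda> x"
      using E_nonneg \<Lambda>_nonneg sp by auto
    show int: "integrable (\<Pi>\<^sub>M k\<in>J. Q) (\<lambda>x. E x / \<Lambda> x)"
      using meas nonneg ratio by (intro integrableI_nonneg) (auto simp: le_less_trans)
    show "(\<integral>x. E x / \<Lambda> x \<partial>(\<Pi>\<^sub>M k\<in>J. Q)) \<le> 1"
      using ratio unfolding nn_integral_eq_integral[OF int nonneg] by simp
  qed
  have comp: "integrable (\<Pi>\<^sub>M k\<in>J. Q) (\<lambda>x. ln (lik (x k)))" "(\<integral>x. ln (lik (x k)) \<partial>(\<Pi>\<^sub>M k\<in>J. Q)) = D"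
    if k: "k \<in> J" for k
  proof -
    have distr: "distr (\<Pi>\<^sub>M k\<in>J. Q) Q (\<lambda>x. x k) = Q"
      using k by (intro distr_PiM_component Q.prob_space_axioms)
    have 1: "(\<lambda>x. x k) \<in> (\<Pi>\<^sub>M k\<in>J. Q) \<rightarrow>\<^sub>M Q" using k by measurable
    have 2: "(\<lambda>x. ln (lik x)) \<in> borel_measurable Q" using integrable_ln_lik(1)[OF D] by (rule borel_measurable_integrable)
    show "integrable (\<Pi>\<^sub>M k\<in>J. Q) (\<lambda>x. ln (lik (x k)))"
      using integrable_distr[OF 1, of "\<lambda>x. ln (lik x)"] integrable_ln_lik(1)[OF D] by (simp add: distr)
    show "(\<integral>x. ln (lik (x k)) \<partial>(\<Pi>\<^sub>M k\<in>J. Q)) = D"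
      using integral_distr[OF 1 2] integrable_ln_lik(2)[OF D] by (simp add: distr)
  qed
  define g where "g x = (\<Sum>k\<in>J. ln (lik (x k))) + (E x / \<Lambda> x - 1)" for x
  have "integrable (\<Pi>\<^sub>M k\<in>J. Q) g"
    unfolding g_def using comp(1) ratio_int(1) by simp
  moreover have "AE x in (\<Pi>\<^sub>M k\<in>J. Q). eln (ennreal (E x)) \<le> ereal (g x)"
  proof -
    \<comment> \<open>Positivity of all factors lets the logarithm of \<open>\<Lambda>\<close> split
      into a sum, so the majorant \<open>g\<close> has mean at most
      \<open>card J * D\<close>.\<close>
    have "AE x in (\<Pi>\<^sub>M k\<in>J. Q). \<forall>k\<in>J. 0 < lik (x k)"
      using J lik_pos by (intro AE_finite_allI AE_PiM_component[of J "\<lambda>_. Q"] Q.prob_space_axioms) auto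
    with AE_space show ?thesis
    proof eventually_elim
      case (elim x)
      have \<Lambda>: "\<Lambda> x > 0" using elim(2) by (simp add: \<Lambda>_def prod_pos)
      have ln_\<Lambda>: "ln (\<Lambda> x) = (\<Sum>k\<in>J. ln (lik (x k)))"
        unfolding \<Lambda>_def using elim(2) J by (intro ln_prod) auto
      show ?case
      proof (cases "E x = 0")
        case False
        then have E: "E x > 0" using E_nonneg[of x] elim(1) sp by fastforce
        then have "ln (E x / \<Lambda> x) \<le> E x / \<Lambda> x - 1" using \<Lambda> by (intro ln_le_minus_one) simp
        then show ?thesis using E \<Lambda> ln_\<Lambda> by (simp add: eln_ennreal g_def ln_div)
      qed (simp add: eln_def)
    qed
  qed
  ultimately have "ext_expectation (\<Pi>\<^sub>M k\<in>J. Q) (\<lambda>x. eln (ennreal (E x))) \<le> ereal (\<integral>x. g x \<partial>(\<Pi>\<^sub>M k\<in>J. Q))"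
    by (rule ext_expectation_le_integral)
  also have "(\<integral>x. g x \<partial>(\<Pi>\<^sub>M k\<in>J. Q)) \<le> card J * D"
    unfolding g_def using comp ratio_int by (simp add: QJ.prob_space Bochner_Integration.integral_sum)
  finally show ?thesis by simp
qed

lemma ext_expectation_eln_le_relative_entropy:
  assumes "prob_space P" "prob_space Q" "sets Q = sets P" and J: "finite J" "J \<noteq> {}"
    and E: "E \<in> borel_measurable (\<Pi>\<^sub>M k\<in>J. P)" "(\<integral>\<^sup>+x. ennreal (E x) \<partial>(\<Pi>\<^sub>M k\<in>J. P)) \<le> 1"
      "\<And>x. x \<in> space (\<Pi>\<^sub>M k\<in>J. P) \<Longrightarrow> 0 \<le> E x"
  shows "ext_expectation (\<Pi>\<^sub>M k\<in>J. Q) (\<lambda>x. eln (ennreal (E x))) / ereal (card J) \<le> relative_entropy Q P"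
proof (cases "relative_entropy Q P = \<infinity>")
  case False
  then have ac: "absolutely_continuous P Q" by (auto simp: relative_entropy_def split: if_splits)
  interpret dominated_prob P Q
    using assms ac by (simp add: dominated_prob_def dominated_prob_axioms_def)
  have "relative_entropy Q P \<noteq> -\<infinity>"
    using neg_part_finite unfolding relative_entropy_lik
    by (cases "\<integral>\<^sup>+x. ennreal (ln (lik x)) \<partial>Q"; cases "\<integral>\<^sup>+x. ennreal (- ln (lik x)) \<partial>Q")
       (auto simp: enn2ereal_ennreal top_unique)
  with False obtain D where D: "relative_entropy Q P = ereal D"
    by (cases "relative_entropy Q P") auto
  have "card J > 0" using J by (simp add: card_gt_0_iff)
  then show ?thesis
    using ext_expectation_eln_le[OF D J(1) E] unfolding D
    by (subst ereal_divide_le_pos) auto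
qed simp

section \<open>The optimal e-power\<close>

text \<open>Preimages under a two-valued map are the whole space, \<open>B\<close>, its complement
  or empty. Pivotality of such an \<open>E\<close> thus reduces to equal probabilities of
  \<open>B\<close>.\<close>

lemma distr_two_valued_cong:
  fixes a b :: real
  assumes "prob_space M" "prob_space N" and sets: "sets M = sets N" and B: "B \<in> sets M"
    and eq: "measure M B = measure N B"
  shows "distr M borel (\<lambda>x. if x \<in> B then a else b) = distr N borel (\<lambda>x. if x \<in> B then a else b)"
proof (rule measure_eqI)
  interpret M: prob_space M by fact
  interpret N: prob_space N by fact
  let ?E = "\<lambda>x. if x \<in> B then a else b"
  have sp: "space N = space M" using sets_eq_imp_space_eq[OF sets] by simp
  have [measurable]: "B \<in> sets M" "B \<in> sets N" using B sets by auto
  fix X assume "X \<in> sets (distr M borel ?E)"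
  then have X: "X \<in> sets borel" by simp
  have B_sub: "B \<subseteq> space M" using B by (rule sets.sets_into_space)
  have compl: "measure M (space M - B) = measure N (space M - B)"
    using M.prob_compl[of B] N.prob_compl[of B] eq sp by simp
  have cases: "?E -` X \<inter> space M \<in> {space M, B, space M - B, {}}"
    using B_sub by (cases "a \<in> X"; cases "b \<in> X") (auto split: if_splits)
  have "measure M (space M) = measure N (space M)"
    using M.prob_space N.prob_space sp by simp
  with cases compl eq have "measure M (?E -` X \<inter> space M) = measure N (?E -` X \<inter> space M)"
    by (elim insertE emptyE) (simp_all only: measure_empty)
  then show "emeasure (distr M borel ?E) X = emeasure (distr N borel ?E) X"
    by (subst (1 2) emeasure_distr) (use X in \<open>simp_all add: sp M.emeasure_eq_measure N.emeasure_eq_measure\<close>)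
qed simp

text \<open>Carries out the randomized test \<open>\<phi>\<close> by a genuine event. Given the
  coordinates in \<open>J\<close>, the fresh coordinate \<open>i\<close> supplies an independent
  uniform variable, which falls below \<open>\<phi>\<close> with conditional probability
  \<open>\<phi>\<close>; Fubini averages this.\<close>

lemma emeasure_PiM_randomized:
  fixes S :: "'a::topological_space measure"
  assumes S: "prob_space S" "sets S = sets borel" and J: "finite J" "i \<notin> J"
    and U: "U \<in> borel_measurable borel" "\<And>t. 0 < t \<Longrightarrow> t < 1 \<Longrightarrow> emeasure S {x. U x \<le> t} = ennreal t"
    and \<phi>: "\<phi> \<in> borel_measurable (\<Pi>\<^sub>M k\<in>J. borel)" "\<And>x. 0 < \<phi> x \<and> \<phi> x < (1::real)"
  shows "measure (\<Pi>\<^sub>M k\<in>insert i J. S) {x \<in> space (\<Pi>\<^sub>M k\<in>insert i J. borel). U (x i) \<le> \<phi> (restrict x J)}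
    = (\<integral>x. \<phi> x \<partial>(\<Pi>\<^sub>M k\<in>J. S))" (is "measure _ ?B = _")
proof -
  interpret S: prob_space S by fact
  interpret PS: product_prob_space "\<lambda>_. S" by standard
  interpret PJ: prob_space "\<Pi>\<^sub>M k\<in>J. S" using S by (intro prob_space_PiM)
  interpret PI: prob_space "\<Pi>\<^sub>M k\<in>insert i J. S" using S by (intro prob_space_PiM)
  have sets: "sets (\<Pi>\<^sub>M k\<in>K. S) = sets (\<Pi>\<^sub>M k\<in>K. borel)" for K :: "'b set"
    using S by (intro sets_PiM_cong) auto
  have sp: "space S = UNIV" using sets_eq_imp_space_eq[OF S(2)] by simp
  have B: "?B \<in> sets (\<Pi>\<^sub>M k\<in>insert i J. borel)"
  proof -
    have [measurable]: "(\<lambda>x. restrict x J) \<in> (\<Pi>\<^sub>M k\<in>insert i J. borel) \<rightarrow>\<^sub>M (\<Pi>\<^sub>M k\<in>J. borel :: 'a measure)"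
      by (rule measurable_restrict_subset) auto
    have [measurable]: "(\<lambda>x. U (x i)) \<in> borel_measurable (\<Pi>\<^sub>M k\<in>insert i J. borel)"
      using U(1) by measurable
    have [measurable]: "(\<lambda>x. \<phi> (restrict x J)) \<in> borel_measurable (\<Pi>\<^sub>M k\<in>insert i J. borel)"
      using \<phi>(1) by measurable
    show ?thesis by measurable
  qed
  have "emeasure (\<Pi>\<^sub>M k\<in>insert i J. S) ?B = (\<integral>\<^sup>+x. indicator ?B x \<partial>(\<Pi>\<^sub>M k\<in>insert i J. S))"
    using B sets by simp
  also have "\<dots> = (\<integral>\<^sup>+x. (\<integral>\<^sup>+y. indicator ?B (x(i := y)) \<partial>S) \<partial>(\<Pi>\<^sub>M k\<in>J. S))"
    using J B sets by (intro PS.product_nn_integral_insert borel_measurable_indicator) auto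
  also have "\<dots> = (\<integral>\<^sup>+x. ennreal (\<phi> x) \<partial>(\<Pi>\<^sub>M k\<in>J. S))"
  proof (rule nn_integral_cong)
    fix x assume "x \<in> space (\<Pi>\<^sub>M k\<in>J. S)"
    then have x: "x \<in> extensional J" by (simp add: space_PiM PiE_def)
    then have "restrict (x(i := y)) J = x" for y
      using J(2) by (auto simp: fun_eq_iff extensional_def)
    moreover have "x(i := y) \<in> space (\<Pi>\<^sub>M k\<in>insert i J. borel)" for y
      using x by (auto simp: space_PiM PiE_def extensional_def)
    ultimately have "indicator ?B (x(i := y)) = (indicator {y. U y \<le> \<phi> x} y :: ennreal)" for y
      by (simp add: indicator_def)
    moreover have "{y. U y \<le> \<phi> x} \<in> sets S"
      unfolding S(2) using U(1) by measurable
    ultimately show "(\<integral>\<^sup>+y. indicator ?B (x(i := y)) \<partial>S) = ennreal (\<phi> x)"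
      using U(2) \<phi>(2) by simp
  qed
  also have "\<dots> = ennreal (\<integral>x. \<phi> x \<partial>(\<Pi>\<^sub>M k\<in>J. S))"
  proof (rule nn_integral_eq_integral)
    show "integrable (\<Pi>\<^sub>M k\<in>J. S) \<phi>"
      using \<phi> by (intro PJ.integrable_const_bound[where B=1])
        (auto simp: measurable_cong_sets[OF sets refl] abs_le_iff less_imp_le intro: order_trans[of _ 0])
  qed (use \<phi>(2) less_imp_le in auto)
  finally show ?thesis
    by (simp add: PI.emeasure_eq_measure integral_nonneg_AE \<phi>(2) less_imp_le)
qed

text \<open>Of the \<open>Suc m\<close> observations one is spent on randomization and
  \<open>m\<close> are tested. \<open>b m\<close> bounds the power from below, and
  \<open>r * m - c\<close> bounds the logarithm of the value of \<open>E\<close> on rejection; the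
  final \<open>ln 2\<close> is the loss on acceptance.\<close>

lemma e_power_opt_lower_bound:
  fixes P :: "nat \<Rightarrow> 'a::topological_space measure" and Q :: "'a measure" and L :: nat and r :: real
  assumes P: "\<And>i. i \<in> {1..L} \<Longrightarrow> prob_space (P i)" "\<And>i. i \<in> {1..L} \<Longrightarrow> sets (P i) = sets borel"
    and Q: "prob_space Q" "sets Q = sets borel"
    and ja: "jointly_atomless (Suc L) (P(Suc L := Q))"
    and r: "r > 0" "\<And>i. i \<in> {1..L} \<Longrightarrow> ereal r < relative_entropy Q (P i)"
  obtains b :: "nat \<Rightarrow> real" and c :: real where "b \<longlonglongrightarrow> 1"
    "\<forall>\<^sub>F m in sequentially. ereal (b m * (r * m - c) - ln 2) \<le> e_power_opt L P Q (Suc m)"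
proof -
  obtain U :: "'a \<Rightarrow> real" where U: "U \<in> borel_measurable borel"
    and U': "\<And>j t. j \<in> {1..Suc L} \<Longrightarrow> 0 < t \<Longrightarrow> t < 1 \<Longrightarrow> emeasure ((P(Suc L := Q)) j) {x. U x \<le> t} = ennreal t"
  proof (rule jointly_atomless_imp_uniform[OF ja])
    show "prob_space ((P(Suc L := Q)) j)" "sets ((P(Suc L := Q)) j) = sets borel" if "j \<in> {1..Suc L}" for j
      using that P Q by (auto simp: le_Suc_eq)
  qed (rule that, assumption, blast)
  have UP: "emeasure (P i) {x. U x \<le> t} = ennreal t" if "i \<in> {1..L}" "0 < t" "t < 1" for i t
    using U'[of i t] that by auto
  have UQ: "emeasure Q {x. U x \<le> t} = ennreal t" if "0 < t" "t < 1" for t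
    using U'[of "Suc L" t] that by auto
  \<comment> \<open>Passing to the set of measures merges repeated \<open>P i\<close>, which could
    not be separated by dual statistics.\<close>
  define W where "W = P ` {1..L}"
  have W: "finite W" "\<And>S. S \<in> W \<Longrightarrow> prob_space S" "\<And>S. S \<in> W \<Longrightarrow> sets S = sets borel"
    "\<And>S. S \<in> W \<Longrightarrow> ereal r < relative_entropy Q S"
    using P r by (auto simp: W_def)
  obtain \<rho> :: "'a measure \<Rightarrow> real" and C :: real where
    rho: "\<And>S. S \<in> W \<Longrightarrow> 0 \<le> \<rho> S \<and> \<rho> S < 1" and C: "C > 0" and
    test: "\<And>J :: nat set. finite J \<Longrightarrow> card W \<le> card J \<Longrightarrow>
       \<exists>\<phi> \<alpha>. \<phi> \<in> borel_measurable (\<Pi>\<^sub>M k\<in>J. borel) \<and> (\<forall>x. 0 < \<phi> x \<and> \<phi> x < 1) \<and>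
         0 < \<alpha> \<and> \<alpha> \<le> C * exp (- r * card J) \<and>
         (\<forall>S\<in>W. (\<integral>x. \<phi> x \<partial>(\<Pi>\<^sub>M k\<in>J. S)) = \<alpha>) \<and>
         (1 - (\<Sum>S\<in>W. \<rho> S ^ card J)) / (1 + 2 * C * exp (- r * card J)) \<le> (\<integral>x. \<phi> x \<partial>(\<Pi>\<^sub>M k\<in>J. Q))"
    using similar_test[of W borel Q r, where 'i=nat, OF W(1,2,3) Q W(4)] by blast
  define b where "b m = (1 - (\<Sum>S\<in>W. \<rho> S ^ m)) / (1 + 2 * C * exp (- r * real m))" for m
  show thesis
  proof (rule that)
    have "(\<lambda>m. exp (- r * real m)) \<longlonglongrightarrow> 0"
      using r(1) by (intro filterlim_compose[OF exp_at_bot] filterlim_tendsto_neg_mult_at_bot[where c="- r"]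
        tendsto_const filterlim_real_sequentially) simp
    then have "b \<longlonglongrightarrow> (1 - (\<Sum>S\<in>W. 0)) / (1 + 2 * C * 0)"
      unfolding b_def using rho by (intro tendsto_intros LIMSEQ_power_zero) auto
    then show "b \<longlonglongrightarrow> 1" by simp
    have lim: "filterlim (\<lambda>m. r * real m) at_top sequentially"
      using r(1) by (intro filterlim_tendsto_pos_mult_at_top[OF tendsto_const] filterlim_real_sequentially)
    show "\<forall>\<^sub>F m in sequentially. ereal (b m * (r * m - ln (2 * C)) - ln 2) \<le> e_power_opt L P Q (Suc m)"
      \<comment> \<open>The first condition makes \<open>r * m - ln (2 * C)\<close> nonnegative, as
        needed when inequalities are multiplied at the end; the second makes
        \<open>similar_test\<close> applicable.\<close>
      using filterlim_at_top[THEN iffD1, OF lim, rule_format, of "ln (2 * C)"] eventually_ge_at_top[of "card W"]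
    proof eventually_elim
      case (elim m)
      define J where "J = {2..Suc m}"
      have J: "finite J" "1 \<notin> J" "card J = m" "{1..Suc m} = insert 1 J"
        by (auto simp: J_def)
      obtain \<phi> \<alpha> where \<phi>: "\<phi> \<in> borel_measurable (\<Pi>\<^sub>M k\<in>J. borel)" "\<And>x. 0 < \<phi> x \<and> \<phi> x < 1"
        and \<alpha>: "0 < \<alpha>" "\<alpha> \<le> C * exp (- r * m)"
        and \<phi>W: "\<And>S. S \<in> W \<Longrightarrow> (\<integral>x. \<phi> x \<partial>(\<Pi>\<^sub>M k\<in>J. S)) = \<alpha>"
        and \<phi>Q: "b m \<le> (\<integral>x. \<phi> x \<partial>(\<Pi>\<^sub>M k\<in>J. Q))"
        using test[OF J(1)] elim(2) unfolding J(3) b_def by blast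
      define \<beta> where "\<beta> = (\<integral>x. \<phi> x \<partial>(\<Pi>\<^sub>M k\<in>J. Q))"
      \<comment> \<open>The solution of \<open>a * \<alpha> + (1 - \<alpha>) / 2 = 1\<close>, which
        is exactness for values \<open>a\<close> on \<open>B\<close> and \<open>1 / 2\<close>
        elsewhere.\<close>
      define a where "a = (1 + \<alpha>) / (2 * \<alpha>)"
      have a: "a > 0" using \<alpha> by (simp add: a_def add_pos_pos)
      define B where "B = {x \<in> space (\<Pi>\<^sub>M k\<in>{1..Suc m}. borel). U (x 1) \<le> \<phi> (restrict x J)}"
      define E where "E = (\<lambda>x. if x \<in> B then a else 1 / 2)"
      have sets: "sets (power_measure (Suc m) S) = sets (power_measure (Suc m) borel)"
        if "sets S = sets borel" for S :: "'a measure"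
        using that by (intro sets_PiM_cong) auto
      have B: "B \<in> sets (power_measure (Suc m) borel)"
      proof -
        have [measurable]: "(\<lambda>x. restrict x J) \<in> (\<Pi>\<^sub>M k\<in>{1..Suc m}. borel) \<rightarrow>\<^sub>M (\<Pi>\<^sub>M k\<in>J. borel :: 'a measure)"
          by (rule measurable_restrict_subset) (auto simp: J_def)
        have [measurable]: "(\<lambda>x. U (x 1)) \<in> borel_measurable (\<Pi>\<^sub>M k\<in>{1..Suc m}. borel)"
          by (rule measurable_compose[OF _ U], rule measurable_component_singleton) simp
        have [measurable]: "(\<lambda>x. \<phi> (restrict x J)) \<in> borel_measurable (\<Pi>\<^sub>M k\<in>{1..Suc m}. borel)"
          using \<phi>(1) by measurable
        show ?thesis unfolding B_def by measurable
      qed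
      have BP: "measure (power_measure (Suc m) (P i)) B = \<alpha>" if "i \<in> {1..L}" for i
        unfolding B_def J(4)
        using emeasure_PiM_randomized[OF P[OF that] J(1,2) U UP[OF that] \<phi>] \<phi>W[of "P i"] that
        by (simp add: W_def)
      have BQ: "measure (power_measure (Suc m) Q) B = \<beta>"
        unfolding B_def J(4) \<beta>_def using Q J(1,2) U UQ \<phi> by (rule emeasure_PiM_randomized)
      have E_meas: "E \<in> borel_measurable (power_measure (Suc m) borel)"
        unfolding E_def using B by measurable
      have pow: "prob_space (power_measure (Suc m) (P i))" if "i \<in> {1..L}" for i
        using P(1)[OF that] by (intro prob_space_PiM)
      have exact: "exact L P (Suc m) E"
        unfolding exact_def
      proof
        fix i assume i: "i \<in> {1..L}"
        interpret p: prob_space "power_measure (Suc m) (P i)" by (rule pow[OF i])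
        have Bi: "B \<in> sets (power_measure (Suc m) (P i))"
          using B sets[OF P(2)[OF i]] by simp
        have "(\<integral>\<^sup>+x. ennreal (E x) \<partial>power_measure (Suc m) (P i)) =
            (\<integral>\<^sup>+x. ennreal (a - 1 / 2 + 1 / 2) * indicator B x + ennreal (1 / 2) * indicator (space (power_measure (Suc m) (P i)) - B) x \<partial>power_measure (Suc m) (P i))"
          by (intro nn_integral_cong) (auto simp: E_def indicator_def)
        also have "\<dots> = ennreal a * ennreal \<alpha> + ennreal (1 / 2) * ennreal (1 - \<alpha>)"
          using Bi BP[OF i] p.prob_compl[OF Bi]
          by (subst nn_integral_add) (auto simp: nn_integral_cmult p.emeasure_eq_measure simp del: One_nat_def)
        also have "\<dots> = ennreal (a * \<alpha> + 1 / 2 * (1 - \<alpha>))"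
        proof -
          have "\<alpha> \<le> 1" using BP[OF i] p.prob_le_1[of B] by simp
          then have "ennreal (a * \<alpha>) = ennreal a * ennreal \<alpha>"
            "ennreal (1 / 2 * (1 - \<alpha>)) = ennreal (1 / 2) * ennreal (1 - \<alpha>)"
            "ennreal (a * \<alpha> + 1 / 2 * (1 - \<alpha>)) = ennreal (a * \<alpha>) + ennreal (1 / 2 * (1 - \<alpha>))"
            using a \<alpha>(1) by (intro ennreal_mult ennreal_plus; simp)+
          then show ?thesis by (simp only:)
        qed
        also have "a * \<alpha> + 1 / 2 * (1 - \<alpha>) = 1"
          using \<alpha> by (simp add: a_def field_simps)
        finally show "(\<integral>\<^sup>+x. ennreal (E x) \<partial>power_measure (Suc m) (P i)) = 1" by simp
      qed
      have pivotal: "pivotal L P (Suc m) E"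
        unfolding pivotal_def E_def
      proof (intro ballI distr_two_valued_cong pow)
        fix i j assume i: "i \<in> {1..L}" and j: "j \<in> {1..L}"
        show "sets (power_measure (Suc m) (P i)) = sets (power_measure (Suc m) (P j))"
          using sets[OF P(2)[OF i]] sets[OF P(2)[OF j]] by simp
        show "B \<in> sets (power_measure (Suc m) (P i))" using B sets[OF P(2)[OF i]] by simp
      qed (simp_all only: BP)
      interpret q: prob_space "power_measure (Suc m) Q"
        using Q by (intro prob_space_PiM)
      have Bq: "B \<in> sets (power_measure (Suc m) Q)" using B sets[OF Q(2)] by simp
      \<comment> \<open>The logarithm of \<open>E\<close> written as an affine function of the
        indicator of \<open>B\<close>; it is bounded because both values of \<open>E\<close> are
        positive.\<close>
      define g where "g = (\<lambda>x. (ln a + ln 2) * indicator B x - ln 2)"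
      have g_int: "integrable (power_measure (Suc m) Q) g"
        unfolding g_def using Bq by (simp add: q.emeasure_eq_measure del: One_nat_def)
      have g_eq: "eln (ennreal (E x)) = ereal (g x)" for x
        using a eln_ennreal[of "1 / 2"] by (simp add: E_def g_def eln_ennreal ln_div del: ennreal_half ennreal_numeral)
      have "E \<in> admissible L P Q (Suc m)"
        using E_meas exact pivotal ext_expectation_eq_integral(2)[OF g_int g_eq] a
        by (auto simp: admissible_def E_def)
      then have "ext_expectation (power_measure (Suc m) Q) (\<lambda>x. eln (ennreal (E x))) \<le> e_power_opt L P Q (Suc m)"
        unfolding e_power_opt_def by (rule SUP_upper)
      also have "ext_expectation (power_measure (Suc m) Q) (\<lambda>x. eln (ennreal (E x))) = ereal ((ln a + ln 2) * \<beta> - ln 2)"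
        unfolding ext_expectation_eq_integral(1)[OF g_int g_eq]
        using Bq BQ by (simp add: g_def q.emeasure_eq_measure q.prob_space del: One_nat_def)
      finally have *: "ereal ((ln a + ln 2) * \<beta> - ln 2) \<le> e_power_opt L P Q (Suc m)" .
      have "r * m - ln (2 * C) \<le> ln a + ln 2"
      proof -
        have "exp (r * m - ln (2 * C)) = 1 / (2 * (C * exp (- r * m)))"
          using C by (simp add: exp_diff exp_minus field_simps)
        also have "\<dots> \<le> 1 / (2 * \<alpha>)"
          using \<alpha> C by (intro divide_left_mono) auto
        also have "\<dots> \<le> a" using \<alpha> by (simp add: a_def divide_right_mono)
        finally have "r * m - ln (2 * C) \<le> ln a" using a by (simp add: ln_ge_iff)
        moreover have "0 \<le> ln (2::real)" by simp
        ultimately show ?thesis by linarith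
      qed
      moreover have "\<beta> \<ge> 0" using BQ by (metis measure_nonneg)
      ultimately have "b m * (r * m - ln (2 * C)) \<le> \<beta> * (ln a + ln 2)"
        using \<phi>Q elim(1) unfolding \<beta>_def[symmetric] by (intro mult_mono) auto
      then have "ereal (b m * (r * m - ln (2 * C)) - ln 2) \<le> ereal ((ln a + ln 2) * \<beta> - ln 2)"
        by (simp add: mult.commute)
      also note *
      finally show ?case .
    qed
  qed
qed

lemma e_power_opt_nonneg:
  assumes P: "\<And>i. i \<in> {1..L} \<Longrightarrow> prob_space (P i)" and Q: "prob_space Q"
  shows "0 \<le> e_power_opt L P Q n"
proof -
  interpret q: prob_space "power_measure n Q" using Q by (intro prob_space_PiM)
  have P': "prob_space (power_measure n (P i))" if "i \<in> {1..L}" for i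
    using P[OF that] by (intro prob_space_PiM)
  have int: "integrable (power_measure n Q) (\<lambda>_. 0::real)" by simp
  have eq: "eln (ennreal 1) = ereal 0" using eln_ennreal[of 1] by simp
  note ext = ext_expectation_eq_integral[OF int, of "\<lambda>_. eln (ennreal 1)", OF eq]
  have "distr (power_measure n (P i)) borel (\<lambda>_. 1) = distr (power_measure n (P j)) borel (\<lambda>_. 1::real)"
    if ij: "i \<in> {1..L}" "j \<in> {1..L}" for i j
    using prob_space.emeasure_space_1[OF P'[OF ij(1)]] prob_space.emeasure_space_1[OF P'[OF ij(2)]]
    by (intro measure_eqI) (auto simp: emeasure_distr)
  then have "pivotal L P n (\<lambda>_. 1)"
    unfolding pivotal_def by blast
  moreover have "exact L P n (\<lambda>_. 1)"
    using prob_space.emeasure_space_1[OF P'] by (simp add: exact_def)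
  ultimately have "(\<lambda>_. 1) \<in> admissible L P Q n"
    using ext(2) by (simp add: admissible_def)
  then have "ext_expectation (power_measure n Q) (\<lambda>_. eln (ennreal 1)) \<le> e_power_opt L P Q n"
    unfolding e_power_opt_def by (rule SUP_upper2) simp
  then show ?thesis using ext(1) by (simp add: zero_ereal_def)
qed

lemma e_power_opt_upper_bound:
  fixes P :: "nat \<Rightarrow> 'a::topological_space measure"
  assumes i: "i \<in> {1..L}" and P: "prob_space (P i)" "sets (P i) = sets borel"
    and Q: "prob_space Q" "sets Q = sets borel" and n: "n \<ge> 1"
  shows "e_power_opt L P Q n / ereal (real n) \<le> relative_entropy Q (P i)"
proof -
  have sets: "sets (power_measure n (P i)) = sets (power_measure n borel)"
    using P by (intro sets_PiM_cong) auto
  have "ext_expectation (power_measure n Q) (\<lambda>x. eln (ennreal (E x))) \<le> relative_entropy Q (P i) * ereal (real n)"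
    if E: "E \<in> admissible L P Q n" for E
  proof -
    have "ext_expectation (power_measure n Q) (\<lambda>x. eln (ennreal (E x))) / ereal (card {1..n}) \<le> relative_entropy Q (P i)"
    proof (rule ext_expectation_eln_le_relative_entropy)
      show "E \<in> borel_measurable (power_measure n (P i))"
        using E unfolding measurable_cong_sets[OF sets refl] by (simp add: admissible_def)
      show "(\<integral>\<^sup>+x. ennreal (E x) \<partial>power_measure n (P i)) \<le> 1"
        using E i by (simp add: admissible_def exact_def)
      show "0 \<le> E x" if "x \<in> space (power_measure n (P i))" for x
        using E that sets_eq_imp_space_eq[OF sets] by (simp add: admissible_def)
    qed (use P Q n in auto)
    then show ?thesis
      using n by (simp add: ereal_divide_le_pos mult.commute)
  qed
  then have "e_power_opt L P Q n \<le> relative_entropy Q (P i) * ereal (real n)"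
    unfolding e_power_opt_def by (rule SUP_least)
  then show ?thesis
    using n by (simp add: ereal_divide_le_pos mult.commute)
qed

section \<open>Squeezing the normalized e-power between the two bounds\<close>

theorem theorem2p2:
  fixes P :: "nat \<Rightarrow> 'a::polish_space measure" and Q :: "'a measure" and L :: nat
  assumes "L \<ge> 1"
    and "\<And>i. i \<in> {1..L} \<Longrightarrow> prob_space (P i)"
    and "\<And>i. i \<in> {1..L} \<Longrightarrow> sets (P i) = sets borel"
    and "prob_space Q"
    and "sets Q = sets borel"
    and "jointly_atomless (Suc L) (P(Suc L := Q))"
    and "Q \<notin> P ` {1..L}"
  shows "((\<lambda>n. e_power_opt L P Q n / ereal (real n)) \<longlonglongrightarrow>
            (MIN i\<in>{1..L}. relative_entropy Q (P i))) \<and>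
         ((\<forall>i\<in>{1..L}. absolutely_continuous Q (P i)) \<longrightarrow>
           (\<lambda>n. e_power_opt L P Q n / ereal (real n)) \<longlonglongrightarrow>
            (MIN i\<in>{1..L}. relative_entropy Q (P i)))"
proof -
  let ?X = "\<lambda>n. e_power_opt L P Q n / ereal (real n)"
  let ?D = "MIN i\<in>{1..L}. relative_entropy Q (P i)"
  have ne: "{1..L} \<noteq> {}" using assms(1) by simp
  have nonneg: "0 \<le> ?X n" for n
    using e_power_opt_nonneg[of L P Q n, OF assms(2,4)] by (simp add: zero_le_divide_ereal)
  have upper: "?X n \<le> ?D" if "n \<ge> 1" for n
  proof (rule Min.boundedI)
    fix d assume "d \<in> (\<lambda>i. relative_entropy Q (P i)) ` {1..L}"
    then obtain i where i: "i \<in> {1..L}" "d = relative_entropy Q (P i)" by blast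
    then show "?X n \<le> d"
      using e_power_opt_upper_bound[of i L P Q n] assms(2-5) that by simp
  qed (use ne in auto)
  have "?X \<longlonglongrightarrow> ?D"
  proof (rule order_tendstoI)
    fix u assume u: "?D < u"
    show "\<forall>\<^sub>F n in sequentially. ?X n < u"
      using eventually_ge_at_top[of 1]
    proof eventually_elim
      case (elim n)
      show ?case using upper[OF elim] u by (rule le_less_trans)
    qed
  next
    fix l assume l: "l < ?D"
    show "\<forall>\<^sub>F n in sequentially. l < ?X n"
    proof (cases "l < 0")
      case True
      then show ?thesis using nonneg by (intro always_eventually allI) (rule less_le_trans)
    next
      case False
      \<comment> \<open>A real rate between \<open>l\<close> and the minimum exists even if the
        minimum is infinite. Since \<open>l\<close> is nonnegative in this case, \<open>r\<close> is
        positive as the lower bound requires, and \<open>l\<close> itself is real.\<close>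
      obtain r where r: "l < ereal r" "ereal r < ?D" using ereal_dense2[OF l] by auto
      obtain s where s: "l = ereal s" "0 \<le> s" "s < r" using False r(1) by (cases l) auto
      have r_pos: "r > 0" using s by simp
      have r_less: "ereal r < relative_entropy Q (P i)" if "i \<in> {1..L}" for i
        using r(2) that by (simp add: Min_gr_iff)
      obtain b c where b: "b \<longlonglongrightarrow> 1" and
        low: "\<forall>\<^sub>F m in sequentially. ereal (b m * (r * real m - c) - ln 2) \<le> e_power_opt L P Q (Suc m)"
        using e_power_opt_lower_bound[of L P Q r, OF assms(2-6) r_pos r_less] by blast
      \<comment> \<open>The sample size is \<open>Suc m\<close>, but only \<open>m\<close>
        observations contribute to the exponent; the ratio tends to 1, so the withheld observation
        does not affect the rate.\<close>
      have "(\<lambda>m. b m * (r * (real m / real (Suc m)) - c / real (Suc m)) - ln 2 / real (Suc m))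
          \<longlonglongrightarrow> 1 * (r * 1 - 0) - 0"
        by (intro tendsto_intros b LIMSEQ_n_over_Suc_n LIMSEQ_Suc[OF lim_const_over_n])
      then have "\<forall>\<^sub>F m in sequentially. s < b m * (r * (real m / real (Suc m)) - c / real (Suc m)) - ln 2 / real (Suc m)"
        using s(3) by (intro order_tendstoD(1)) auto
      with low have "\<forall>\<^sub>F m in sequentially. l < ?X (Suc m)"
      proof eventually_elim
        case (elim m)
        have "s < (b m * (r * real m - c) - ln 2) / real (Suc m)"
          using elim(2) by (simp add: diff_divide_distrib right_diff_distrib)
        then have "l < ereal (b m * (r * real m - c) - ln 2) / ereal (real (Suc m))"
          using s(1) by simp
        also have "\<dots> \<le> ?X (Suc m)"
          using elim(1) by (intro ereal_divide_right_mono) auto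
        finally show ?case .
      qed
      then show ?thesis
        using eventually_sequentially_Suc[of "\<lambda>n. l < ?X n"] by blast
    qed
  qed
  then show ?thesis by blast
qed

end
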